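(* Let $d\notin\{0,1\}$ be a square-free integer and $m\geq 1$ an integer such that it is not the case that both $d\equiv 1\pmod 4$ and $m$ is odd. Let $q_{d,m}=(1,0,-c_{d,m})$, i.e. $q_{d,m}(x,y)=x^2-c_{d,m}y^2$. Then $$H^1_{\mathrm{fl}}(\mathbb{Z},\underline{\mathbf{O}}_{d,m})=H^1_{\mathrm{fl}}(\mathbb{Z},\underline{\mathbf{O}}_{d,m}^+)/\underline\mu_2(\mathbb{Z})\ \coprod\ H^1_{\mathrm{fl}}(\mathbb{Z},\underline{\mathbf{O}}^+_{(1,0,c_{d,m})})/\underline\mu_2(\mathbb{Z}),$$ where the non-trivial element of $\underline\mu_2(\mathbb{Z})=\{\pm1\}$ maps the class $[(a_0,b_0,c_0)]$ to $[(a_0,-b_0,c_0)]$.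
   Context: Notation $(a,b,c)$ stands for the binary quadratic form $ax^2+bxy+cy^2$ with $a,b,c\in\mathbb{Z}$. Put $c_{d,m}=\frac{m^2d}{4}$ if $d\equiv 1\pmod 4$ and $m$ is even, and $c_{d,m}=m^2d$ if $d\equiv 2,3\pmod 4$; then $q_{d,m}$ is the norm form, for a suitable $\mathbb{Z}$-basis, of the unique order of index $m$ in the ring of integers of $\mathbb{Q}(\sqrt d)$. For a binary form $q$ of non-zero discriminant, $\underline{\mathbf{O}}_q$ is the affine $\mathbb{Z}$-group scheme $\{A\in\mathbf{GL}_2:q\circ A=q\}$; $\widetilde{\underline{\mathbf{O}}}_q$ is the schematic closure in $\underline{\mathbf{O}}_q$ of its generic fiber; $\underline{\mathbf{O}}_q^+$ is the schematic closure in $\underline{\mathbf{O}}_q$ of $\ker[\det:\underline{\mathbf{O}}_q\otimes\mathbb{Q}\to\mu_2]$. Write $\underline{\mathbf{O}}_{d,m}=\underline{\mathbf{O}}_{q_{d,m}}$, etc. $H^1_{\mathrm{fl}}(\mathbb{Z},\cdot)$ is first flat (fppf) cohomology over $\mathrm{Spec}\,\mathbb{Z}$, and $H^1_{\mathrm{fl}}(\mathbb{Z},\underline{\mathbf{O}}_q)$ is identified with $H^1_{\mathrm{fl}}(\mathbb{Z},\widetilde{\underline{\mathbf{O}}}_q)$. Elements of $H^1_{\mathrm{fl}}(\mathbb{Z},\underline{\mathbf{O}}_q)$ (resp. $H^1_{\mathrm{fl}}(\mathbb{Z},\underline{\mathbf{O}}_q^+)$) are identified with classes $[q']$ of integral binary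 forms that are isomorphic (resp. properly isomorphic, i.e. by isometries of determinant 1) to $q$ locally in the fppf topology, modulo $\mathbf{GL}_2(\mathbb{Z})$ (resp. $\mathbf{SL}_2(\mathbb{Z})$). *)

theory Defs
  imports
    "HOL-Algebra.Free_Abelian_Groups"
    "HOL-Algebra.Group_Action"
    "HOL-Algebra.IntRing"
    "HOL-Computational_Algebra.Squarefree"
begin

section \<open>The fppf topology on the spectrum of the integers\<close>

subsection \<open>Flatness\<close>

text \<open>
  \<open>tensor M N\<close> is the tensor product over the integers of two (multiplicatively written)
  abelian groups: the free abelian group on \<open>carrier M \<times> carrier N\<close> modulo the subgroup
  generated by the bilinearity relations (\<open>\<int>\<close>-balancedness follows from biadditivity).
\<close>

definition tensor_relations ::
  "('a, 'm) monoid_scheme \<Rightarrow> ('b, 'n) monoid_scheme \<Rightarrow> ('a \<times> 'b \<Rightarrow>\<^sub>0 int) set" where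
  "tensor_relations M N = generate (free_Abelian_group (carrier M \<times> carrier N))
     ({frag_of (x \<otimes>\<^bsub>M\<^esub> x', y) - frag_of (x, y) - frag_of (x', y) | x x' y.
         x \<in> carrier M \<and> x' \<in> carrier M \<and> y \<in> carrier N} \<union>
      {frag_of (x, y \<otimes>\<^bsub>N\<^esub> y') - frag_of (x, y) - frag_of (x, y') | x y y'.
         x \<in> carrier M \<and> y \<in> carrier N \<and> y' \<in> carrier N})"

definition tensor ::
  "('a, 'm) monoid_scheme \<Rightarrow> ('b, 'n) monoid_scheme \<Rightarrow> ('a \<times> 'b \<Rightarrow>\<^sub>0 int) set monoid" where
  "tensor M N = free_Abelian_group (carrier M \<times> carrier N) Mod tensor_relations M N"

text \<open>
  \<open>tensor_map M N' \<phi>\<close> is the homomorphism \<open>id \<otimes> \<phi>\<close> from \<open>tensor M N\<close> to \<open>tensor M N'\<close>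
  induced by a homomorphism \<open>\<phi>\<close> from \<open>N\<close> to \<open>N'\<close>; it sends a coset to the coset
  containing its image.
\<close>

definition tensor_map ::
  "('a, 'm) monoid_scheme \<Rightarrow> ('c, 'n) monoid_scheme \<Rightarrow> ('b \<Rightarrow> 'c)
     \<Rightarrow> ('a \<times> 'b \<Rightarrow>\<^sub>0 int) set \<Rightarrow> ('a \<times> 'c \<Rightarrow>\<^sub>0 int) set" where
  "tensor_map M N' \<phi> X =
     tensor_relations M N' <#>\<^bsub>free_Abelian_group (carrier M \<times> carrier N')\<^esub>
       (frag_extend (\<lambda>(x, y). frag_of (x, \<phi> y)) ` X)"

text \<open>
  The test modules \<open>N\<close>, \<open>N'\<close> range over all countable abelian groups (carriers inside the
  type \<^typ>\<open>int\<close>).  This is no restriction, since flatness can be tested on finitely generated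
  modules.
\<close>

definition flat_abelian_group :: "('a, 'm) monoid_scheme \<Rightarrow> bool" where
  "flat_abelian_group M \<longleftrightarrow>
     (\<forall>(N :: int monoid) (N' :: int monoid) \<phi>.
        comm_group N \<longrightarrow> comm_group N' \<longrightarrow> \<phi> \<in> mon N N' \<longrightarrow>
        inj_on (tensor_map M N' \<phi>) (carrier (tensor M N)))"

subsection \<open>Finite presentation\<close>

text \<open>
  \<open>int_mpoly n\<close> is the ring of integral polynomials in the variables with indices \<open>0, \<dots>, n - 1\<close>;
  a monomial is a finitely supported function from variable indices to exponents.
\<close>

definition int_mpoly :: "nat \<Rightarrow> ((nat \<Rightarrow>\<^sub>0 nat) \<Rightarrow>\<^sub>0 int) ring" where
  "int_mpoly n =
     \<lparr>carrier = {p. \<forall>u \<in> Poly_Mapping.keys p. Poly_Mapping.keys u \<subseteq> {..<n}},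
      monoid.mult = (*), one = 1, zero = 0, add = (+)\<rparr>"

definition finitely_presented_ring :: "('a, 'm) ring_scheme \<Rightarrow> bool" where
  "finitely_presented_ring R \<longleftrightarrow>
     (\<exists>n h F. h \<in> ring_hom (int_mpoly n) R \<and> h ` carrier (int_mpoly n) = carrier R \<and>
        finite F \<and> F \<subseteq> carrier (int_mpoly n) \<and>
        a_kernel (int_mpoly n) R h = Idl\<^bsub>int_mpoly n\<^esub> F)"

subsection \<open>Coverings\<close>

definition of_int_ring :: "('a, 'm) ring_scheme \<Rightarrow> int \<Rightarrow> 'a" where
  "of_int_ring R k = [k] \<cdot>\<^bsub>R\<^esub> \<one>\<^bsub>R\<^esub>"

definition spec_surjective :: "('a, 'm) ring_scheme \<Rightarrow> bool" where
  "spec_surjective R \<longleftrightarrow>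
     (\<forall>P. primeideal P \<Z> \<longrightarrow> (\<exists>Q. primeideal Q R \<and> of_int_ring R -` Q = P))"

text \<open>
  As \<open>Spec \<int>\<close> is quasi-compact, every fppf covering of it is refined by a single affine one
  \<open>Spec R \<rightarrow> Spec \<int>\<close>.
\<close>

definition fppf_cover :: "('a, 'm) ring_scheme \<Rightarrow> bool" where
  "fppf_cover R \<longleftrightarrow> cring R \<and> flat_abelian_group (add_monoid R) \<and>
     finitely_presented_ring R \<and> spec_surjective R"


section \<open>Binary quadratic forms\<close>

text \<open>
  The triple \<open>(a, b, c)\<close> is the form \<open>a x\<^sup>2 + b x y + c y\<^sup>2\<close>, and the quadruple \<open>(p, q, r, s)\<close>
  is the matrix with rows \<open>(p, q)\<close> and \<open>(r, s)\<close>.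
\<close>

type_synonym 'a bqf = "'a \<times> 'a \<times> 'a"
type_synonym 'a mat2 = "'a \<times> 'a \<times> 'a \<times> 'a"

definition det2 :: "('a, 'm) ring_scheme \<Rightarrow> 'a mat2 \<Rightarrow> 'a" where
  "det2 R = (\<lambda>(p, q, r, s). p \<otimes>\<^bsub>R\<^esub> s \<ominus>\<^bsub>R\<^esub> q \<otimes>\<^bsub>R\<^esub> r)"

definition GL2 :: "('a, 'm) ring_scheme \<Rightarrow> 'a mat2 set" where
  "GL2 R = {A \<in> carrier R \<times> carrier R \<times> carrier R \<times> carrier R. det2 R A \<in> Units R}"

definition SL2 :: "('a, 'm) ring_scheme \<Rightarrow> 'a mat2 set" where
  "SL2 R = {A \<in> GL2 R. det2 R A = \<one>\<^bsub>R\<^esub>}"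

text \<open>
  The coefficients of \<open>f \<circ> A\<close>, that is, of \<open>f\<close> after the substitution of \<open>p x + q y\<close> for \<open>x\<close>
  and of \<open>r x + s y\<close> for \<open>y\<close>.
\<close>

definition bqf_subst :: "('a, 'm) ring_scheme \<Rightarrow> 'a bqf \<Rightarrow> 'a mat2 \<Rightarrow> 'a bqf" where
  "bqf_subst R = (\<lambda>(a, b, c) (p, q, r, s).
     (a \<otimes>\<^bsub>R\<^esub> p \<otimes>\<^bsub>R\<^esub> p \<oplus>\<^bsub>R\<^esub> b \<otimes>\<^bsub>R\<^esub> p \<otimes>\<^bsub>R\<^esub> r \<oplus>\<^bsub>R\<^esub> c \<otimes>\<^bsub>R\<^esub> r \<otimes>\<^bsub>R\<^esub> r,
      (a \<otimes>\<^bsub>R\<^esub> p \<otimes>\<^bsub>R\<^esub> q \<oplus>\<^bsub>R\<^esub> a \<otimes>\<^bsub>R\<^esub> p \<otimes>\<^bsub>R\<^esub> q) \<oplus>\<^bsub>R\<^esub>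
        b \<otimes>\<^bsub>R\<^esub> (p \<otimes>\<^bsub>R\<^esub> s \<oplus>\<^bsub>R\<^esub> q \<otimes>\<^bsub>R\<^esub> r) \<oplus>\<^bsub>R\<^esub>
        (c \<otimes>\<^bsub>R\<^esub> r \<otimes>\<^bsub>R\<^esub> s \<oplus>\<^bsub>R\<^esub> c \<otimes>\<^bsub>R\<^esub> r \<otimes>\<^bsub>R\<^esub> s),
      a \<otimes>\<^bsub>R\<^esub> q \<otimes>\<^bsub>R\<^esub> q \<oplus>\<^bsub>R\<^esub> b \<otimes>\<^bsub>R\<^esub> q \<otimes>\<^bsub>R\<^esub> s \<oplus>\<^bsub>R\<^esub> c \<otimes>\<^bsub>R\<^esub> s \<otimes>\<^bsub>R\<^esub> s))"

definition bqf_base_change :: "('a, 'm) ring_scheme \<Rightarrow> int bqf \<Rightarrow> 'a bqf" where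
  "bqf_base_change R = (\<lambda>(a, b, c). (of_int_ring R a, of_int_ring R b, of_int_ring R c))"

text \<open>
  Isometries over \<open>R\<close>.  In particular \<open>isometries R f f\<close> is the group of \<open>R\<close>-points of the
  orthogonal group scheme of \<open>f\<close>.
\<close>

definition isometries :: "('a, 'm) ring_scheme \<Rightarrow> int bqf \<Rightarrow> int bqf \<Rightarrow> 'a mat2 set" where
  "isometries R f f' =
     {A \<in> GL2 R. bqf_subst R (bqf_base_change R f') A = bqf_base_change R f}"

definition proper_isometries :: "('a, 'm) ring_scheme \<Rightarrow> int bqf \<Rightarrow> int bqf \<Rightarrow> 'a mat2 set" where
  "proper_isometries R f f' = isometries R f f' \<inter> SL2 R"

definition full_class :: "int bqf \<Rightarrow> int bqf set" where
  "full_class f = bqf_subst \<Z> f ` GL2 \<Z>"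

definition proper_class :: "int bqf \<Rightarrow> int bqf set" where
  "proper_class f = bqf_subst \<Z> f ` SL2 \<Z>"


section \<open>Flat cohomology of the orthogonal groups of a binary form\<close>

text \<open>
  \<open>H1_O f\<close> and \<open>H1_Oplus f\<close> are the first flat cohomology sets over \<open>Spec \<int>\<close> of the orthogonal
  group of \<open>f\<close> and of its subgroup \<open>O\<^sup>+\<close>, through their descriptions by twisted forms of \<open>f\<close>: classes
  of integral forms that are isometric, respectively properly isometric, to \<open>f\<close> over some fppf
  covering of \<open>Spec \<int>\<close>.  Here \<open>O\<^sup>+\<close> is the schematic closure of the kernel of the determinant on the
  generic fibre; its points over a flat \<open>R\<close> are the isometries of determinant 1.  A finitely presented \<open>\<int>\<close>-algebra is countable, so coverings with carrier
  inside the type \<^typ>\<open>nat\<close> represent all affine ones up to isomorphism.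
\<close>

definition fppf_isometric :: "int bqf \<Rightarrow> int bqf \<Rightarrow> bool" where
  "fppf_isometric f f' \<longleftrightarrow> (\<exists>R :: nat ring. fppf_cover R \<and> isometries R f f' \<noteq> {})"

definition fppf_properly_isometric :: "int bqf \<Rightarrow> int bqf \<Rightarrow> bool" where
  "fppf_properly_isometric f f' \<longleftrightarrow>
     (\<exists>R :: nat ring. fppf_cover R \<and> proper_isometries R f f' \<noteq> {})"

definition H1_O :: "int bqf \<Rightarrow> int bqf set set" where
  "H1_O f = full_class ` {f'. fppf_isometric f f'}"

definition H1_Oplus :: "int bqf \<Rightarrow> int bqf set set" where
  "H1_Oplus f = proper_class ` {f'. fppf_properly_isometric f f'}"

definition mu2_Z :: "int monoid" where
  "mu2_Z = \<lparr>carrier = {e. e\<^sup>2 = 1}, monoid.mult = (*), one = 1\<rparr>"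

text \<open>
  The action of \<open>\<mu>\<^sub>2(\<int>)\<close> on proper classes, as a map into the bijections of \<open>H1_Oplus f\<close>;
  the value outside \<open>H1_Oplus f\<close> is made undefined, as required by \<^const>\<open>BijGroup\<close>.
\<close>

definition mu2_action :: "int bqf \<Rightarrow> int \<Rightarrow> int bqf set \<Rightarrow> int bqf set" where
  "mu2_action f e = (\<lambda>X \<in> H1_Oplus f. (\<lambda>(a, b, c). (a, e * b, c)) ` X)"

definition mu2_orbit :: "int bqf \<Rightarrow> int bqf set \<Rightarrow> int bqf set set" where
  "mu2_orbit f X = orbit mu2_Z (mu2_action f) X"

definition H1_Oplus_mod_mu2 :: "int bqf \<Rightarrow> int bqf set set set" where
  "H1_Oplus_mod_mu2 f = orbits mu2_Z (H1_Oplus f) (mu2_action f)"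


section \<open>The forms attached to quadratic orders\<close>

text \<open>The division by 4 is exact when \<open>m\<close> is even; \<open>d mod 4 = 1\<close> with \<open>m\<close> odd is never used.\<close>

definition c_dm :: "int \<Rightarrow> int \<Rightarrow> int" where
  "c_dm d m = (if d mod 4 = 1 then m\<^sup>2 * d div 4 else m\<^sup>2 * d)"

definition q_dm :: "int \<Rightarrow> int \<Rightarrow> int bqf" where
  "q_dm d m = (1, 0, - c_dm d m)"

end

theory Submission
  imports
    Defs
    "HOL-Algebra.Multiplicative_Group"
    "HOL-Decision_Procs.Commutative_Ring"
begin

text \<open>
  The argument compares discriminants.  Write \<open>q = (1, 0, -c)\<close> and \<open>q' = (1, 0, c)\<close>, where
  \<open>c \<noteq> 0\<close>, so that \<open>q\<close> and \<open>q'\<close> have discriminants \<open>4 c\<close> and \<open>- 4 c\<close>.  Suppose that \<open>A\<close> is an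
  isometry from \<open>q\<close> to \<open>f\<close> over a covering \<open>R\<close>, with determinant \<open>\<delta>\<close>.  Then \<open>4 c = \<delta>\<^sup>2 disc f\<close> in \<open>R\<close>.
  As \<open>R\<close> is torsion-free (\<open>flat_abelian_group_torsion_free\<close>) and \<open>Spec R\<close> maps onto \<open>Spec \<int>\<close>, two
  integers that differ by a unit of \<open>R\<close> differ by a sign (\<open>fppf_cover_associated\<close>), so \<open>\<delta>\<^sup>2 = \<plusminus>1\<close>.
  The product of \<open>A\<close> and \<open>diag(1, \<delta>\<^sup>-\<^sup>1)\<close> has determinant 1, and it is an isometry to \<open>f\<close> from \<open>q\<close> if
  \<open>\<delta>\<^sup>2 = 1\<close> and from \<open>q'\<close> if \<open>\<delta>\<^sup>2 = -1\<close>.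

  Conversely \<open>diag(1, \<i>)\<close> is an isometry between \<open>q'\<close> and \<open>q\<close> over any ring that contains a square
  root \<open>\<i>\<close> of \<open>-1\<close>, so a form that is locally properly isometric to \<open>q'\<close> is locally isometric to
  \<open>q\<close>.  This requires that \<open>R[\<i>]\<close> is again a covering if \<open>R\<close> is one (\<open>fppf_cover_gauss_ring\<close>).
  It is flat because its additive group is \<open>R \<oplus> R\<close>; a presentation of \<open>R\<close> yields one of \<open>R[\<i>]\<close> with
  one more variable \<open>X\<close> and one more relation \<open>X\<^sup>2 + 1\<close>; and over each prime of \<open>R\<close> there lies an
  explicit prime of \<open>R[\<i>]\<close>.  The two facts together are \<open>fppf_isometric_diagonal_iff\<close>.

  It remains to pass to classes.  The \<open>GL\<^sub>2(\<int>)\<close>-class of \<open>f = (a, b, c)\<close> is the union of the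
  \<open>SL\<^sub>2(\<int>)\<close>-classes of \<open>f\<close> and \<open>(a, -b, c)\<close>, hence an orbit of \<open>\<mu>\<^sub>2(\<int>)\<close> on proper classes is
  determined by its union, which is the full class.  The bijection is therefore given by unions,
  and the two summands have disjoint images because the discriminant is constant on full classes.
\<close>

section \<open>Forms and matrices over commutative rings\<close>

text \<open>
  The matrix product: substituting \<open>A\<close> and then \<open>B\<close> in a form is substituting \<open>mat2_mult R A B\<close>.
\<close>

definition mat2_mult :: "('a, 'm) ring_scheme \<Rightarrow> 'a mat2 \<Rightarrow> 'a mat2 \<Rightarrow> 'a mat2" where
  "mat2_mult R = (\<lambda>(p, q, r, s) (p', q', r', s').
     (p \<otimes>\<^bsub>R\<^esub> p' \<oplus>\<^bsub>R\<^esub> q \<otimes>\<^bsub>R\<^esub> r', p \<otimes>\<^bsub>R\<^esub> q' \<oplus>\<^bsub>R\<^esub> q \<otimes>\<^bsub>R\<^esub> s',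
      r \<otimes>\<^bsub>R\<^esub> p' \<oplus>\<^bsub>R\<^esub> s \<otimes>\<^bsub>R\<^esub> r', r \<otimes>\<^bsub>R\<^esub> q' \<oplus>\<^bsub>R\<^esub> s \<otimes>\<^bsub>R\<^esub> s'))"

text \<open>
  The discriminant \<open>b\<^sup>2 - 4 a c\<close>; the factor 4 is written out as a sum.
\<close>

definition bqf_disc :: "('a, 'm) ring_scheme \<Rightarrow> 'a bqf \<Rightarrow> 'a" where
  "bqf_disc R = (\<lambda>(a, b, c). b \<otimes>\<^bsub>R\<^esub> b \<ominus>\<^bsub>R\<^esub>
     (a \<otimes>\<^bsub>R\<^esub> c \<oplus>\<^bsub>R\<^esub> a \<otimes>\<^bsub>R\<^esub> c \<oplus>\<^bsub>R\<^esub> a \<otimes>\<^bsub>R\<^esub> c \<oplus>\<^bsub>R\<^esub> a \<otimes>\<^bsub>R\<^esub> c))"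

text \<open>
  The syntactic polynomial expressions, as a record of ring operations (not a ring: the
  expressions are not identified).  Evaluating \<open>bqf_subst\<close> over it yields the expressions behind the coefficients of a
  substituted form.  Equality of their normal forms, which is a computation, then gives the identity
  in every commutative ring through \<open>norm_eq\<close>.
\<close>

definition polex_ring :: "polex ring" where
  "polex_ring = \<lparr>carrier = UNIV, monoid.mult = Mul, one = Const 1, zero = Const 0, add = Add\<rparr>"

context cring
begin

lemma mat2_mult_closed:
  "A \<in> carrier R \<times> carrier R \<times> carrier R \<times> carrier R \<Longrightarrow>
   B \<in> carrier R \<times> carrier R \<times> carrier R \<times> carrier R \<Longrightarrow>
   mat2_mult R A B \<in> carrier R \<times> carrier R \<times> carrier R \<times> carrier R"
  by (auto simp: mat2_mult_def)

lemma det2_mult: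
  assumes "A \<in> carrier R \<times> carrier R \<times> carrier R \<times> carrier R"
    and "B \<in> carrier R \<times> carrier R \<times> carrier R \<times> carrier R"
  shows "det2 R (mat2_mult R A B) = det2 R A \<otimes> det2 R B"
proof -
  obtain p q r s p' q' r' s' where [simp]: "A = (p, q, r, s)" "B = (p', q', r', s')"
    by (metis prod_cases4)
  have l: "in_carrier [p, q, r, s, p', q', r', s']"
    using assms by (simp add: in_carrier_def)
  have "norm (Sub (Mul (Add (Mul (Var 0) (Var 4)) (Mul (Var 1) (Var 6)))
                       (Add (Mul (Var 2) (Var 5)) (Mul (Var 3) (Var 7))))
                  (Mul (Add (Mul (Var 0) (Var 5)) (Mul (Var 1) (Var 7)))
                       (Add (Mul (Var 2) (Var 4)) (Mul (Var 3) (Var 6)))))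
      = norm (Mul (Sub (Mul (Var 0) (Var 3)) (Mul (Var 1) (Var 2)))
                  (Sub (Mul (Var 4) (Var 7)) (Mul (Var 5) (Var 6))))"
    by code_simp
  from norm_eq[OF l this] show ?thesis
    by (simp add: det2_def mat2_mult_def)
qed

lemma bqf_subst_mult:
  assumes "f \<in> carrier R \<times> carrier R \<times> carrier R"
    and "A \<in> carrier R \<times> carrier R \<times> carrier R \<times> carrier R"
    and "B \<in> carrier R \<times> carrier R \<times> carrier R \<times> carrier R"
  shows "bqf_subst R (bqf_subst R f A) B = bqf_subst R f (mat2_mult R A B)"
proof -
  obtain a b c p q r s p' q' r' s'
    where [simp]: "f = (a, b, c)" "A = (p, q, r, s)" "B = (p', q', r', s')"
    by (metis prod_cases3 prod_cases4)
  let ?f = "(Var 0, Var 1, Var 2)"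
  let ?A = "(Var 3, Var 4, Var 5, Var 6)"
  let ?B = "(Var 7, Var 8, Var 9, Var 10)"
  let ?L = "bqf_subst polex_ring (bqf_subst polex_ring ?f ?A) ?B"
  let ?R = "bqf_subst polex_ring ?f (mat2_mult polex_ring ?A ?B)"
  have l: "in_carrier [a, b, c, p, q, r, s, p', q', r', s']"
    using assms by (simp add: in_carrier_def)
  have 1: "norm (fst ?L) = norm (fst ?R)"
    by code_simp
  have 2: "norm (fst (snd ?L)) = norm (fst (snd ?R))"
    by code_simp
  have 3: "norm (snd (snd ?L)) = norm (snd (snd ?R))"
    by code_simp
  show ?thesis
    using norm_eq[OF l 1] norm_eq[OF l 2] norm_eq[OF l 3]
    by (simp add: bqf_subst_def mat2_mult_def polex_ring_def)
qed

text \<open>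
  In terms of Gram matrices, the discriminant is minus a determinant, whence the square.
\<close>

lemma bqf_disc_subst:
  assumes "f \<in> carrier R \<times> carrier R \<times> carrier R"
    and "A \<in> carrier R \<times> carrier R \<times> carrier R \<times> carrier R"
  shows "bqf_disc R (bqf_subst R f A) = det2 R A \<otimes> det2 R A \<otimes> bqf_disc R f"
proof -
  obtain a b c p q r s where [simp]: "f = (a, b, c)" "A = (p, q, r, s)"
    by (metis prod_cases3 prod_cases4)
  have l: "in_carrier [a, b, c, p, q, r, s]"
    using assms by (simp add: in_carrier_def)
  let ?F = "bqf_subst polex_ring (Var 0, Var 1, Var 2) (Var 3, Var 4, Var 5, Var 6)"
  let ?d = "\<lambda>(a, b, c). Sub (Mul b b) (Add (Add (Add (Mul a c) (Mul a c)) (Mul a c)) (Mul a c))"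
  let ?D = "Sub (Mul (Var 3) (Var 6)) (Mul (Var 4) (Var 5))"
  have 1: "norm (?d ?F) = norm (Mul (Mul ?D ?D) (?d (Var 0, Var 1, Var 2)))"
    by code_simp
  show ?thesis
    using norm_eq[OF l 1] by (simp add: bqf_subst_def bqf_disc_def det2_def polex_ring_def)
qed

end

text \<open>
  Base change of forms and matrices along a ring homomorphism.
\<close>

definition map_bqf :: "('a \<Rightarrow> 'b) \<Rightarrow> 'a bqf \<Rightarrow> 'b bqf" where
  "map_bqf h = (\<lambda>(a, b, c). (h a, h b, h c))"

definition map_mat2 :: "('a \<Rightarrow> 'b) \<Rightarrow> 'a mat2 \<Rightarrow> 'b mat2" where
  "map_mat2 h = (\<lambda>(p, q, r, s). (h p, h q, h r, h s))"

context ring_hom_ring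
begin

lemma hom_minus: "x \<in> carrier R \<Longrightarrow> y \<in> carrier R \<Longrightarrow> h (x \<ominus>\<^bsub>R\<^esub> y) = h x \<ominus>\<^bsub>S\<^esub> h y"
  by (simp add: R.minus_eq S.minus_eq)

lemma det2_map_mat2:
  assumes "A \<in> carrier R \<times> carrier R \<times> carrier R \<times> carrier R"
  shows "det2 S (map_mat2 h A) = h (det2 R A)"
  using assms by (auto simp: det2_def map_mat2_def hom_minus)

lemma bqf_subst_map:
  assumes "f \<in> carrier R \<times> carrier R \<times> carrier R"
    and "A \<in> carrier R \<times> carrier R \<times> carrier R \<times> carrier R"
  shows "bqf_subst S (map_bqf h f) (map_mat2 h A) = map_bqf h (bqf_subst R f A)"
  using assms by (auto simp: bqf_subst_def map_bqf_def map_mat2_def)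

lemma bqf_disc_map:
  assumes "f \<in> carrier R \<times> carrier R \<times> carrier R"
  shows "bqf_disc S (map_bqf h f) = h (bqf_disc R f)"
  using assms by (auto simp: bqf_disc_def map_bqf_def hom_minus)

lemma map_mat2_closed:
  assumes "A \<in> carrier R \<times> carrier R \<times> carrier R \<times> carrier R"
  shows "map_mat2 h A \<in> carrier S \<times> carrier S \<times> carrier S \<times> carrier S"
  using assms by (auto simp: map_mat2_def)

lemma hom_Units: "x \<in> Units R \<Longrightarrow> h x \<in> Units S"
  unfolding Units_def by clarsimp (metis hom_closed hom_mult hom_one)

lemma map_mat2_GL2: "A \<in> GL2 R \<Longrightarrow> map_mat2 h A \<in> GL2 S"
  by (simp add: GL2_def map_mat2_closed det2_map_mat2 hom_Units)

lemma of_int_ring_hom: "h (of_int_ring R k) = of_int_ring S k"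
  using group_hom.hom_int_pow[OF a_group_hom, of "\<one>\<^bsub>R\<^esub>" k]
  by (simp add: of_int_ring_def add_pow_def)

lemma bqf_base_change_map: "bqf_base_change S f = map_bqf h (bqf_base_change R f)"
  by (simp add: bqf_base_change_def map_bqf_def of_int_ring_hom split: prod.splits)

end

lemma (in ring) of_int_ring_hom_ring: "ring_hom_ring \<Z> R (of_int_ring R)"
proof (rule ring_hom_ringI2)
  show "ring \<Z>"
    by (rule cring.axioms(1)[OF int_is_cring])
  show "ring R"
    by (rule ring_axioms)
  show "of_int_ring R \<in> ring_hom \<Z> R"
  proof (rule ring_hom_memI)
    fix k l :: int
    show "of_int_ring R k \<in> carrier R"
      by (simp add: of_int_ring_def)
    show "of_int_ring R (k \<oplus>\<^bsub>\<Z>\<^esub> l) = of_int_ring R k \<oplus> of_int_ring R l"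
      by (simp add: of_int_ring_def add.int_pow_mult)
    have "of_int_ring R k \<otimes> of_int_ring R l = add_pow R k (add_pow R l \<one>)"
      by (simp add: of_int_ring_def add_pow_ldistr_int)
    also have "\<dots> = add_pow R (l * k) \<one>"
      using add.int_pow_pow[of \<one> k l] by simp
    finally show "of_int_ring R (k \<otimes>\<^bsub>\<Z>\<^esub> l) = of_int_ring R k \<otimes> of_int_ring R l"
      by (simp add: of_int_ring_def mult.commute)
    show "of_int_ring R \<one>\<^bsub>\<Z>\<^esub> = \<one>"
      by (simp add: of_int_ring_def)
  qed
qed

lemma (in ring) bqf_base_change_eq: "bqf_base_change R = map_bqf (of_int_ring R)"
  by (simp add: bqf_base_change_def map_bqf_def fun_eq_iff)

section \<open>Flatness and coverings of the spectrum of the integers\<close>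

text \<open>
  The map \<open>\<alpha> \<otimes> \<beta>\<close> on the free abelian groups of which the tensor products are quotients.
\<close>

definition tensor_lift :: "('a \<Rightarrow> 'c) \<Rightarrow> ('b \<Rightarrow> 'd) \<Rightarrow> ('a \<times> 'b \<Rightarrow>\<^sub>0 int) \<Rightarrow> ('c \<times> 'd \<Rightarrow>\<^sub>0 int)" where
  "tensor_lift \<alpha> \<beta> = frag_extend (\<lambda>(x, y). frag_of (\<alpha> x, \<beta> y))"

lemma tensor_lift_of [simp]: "tensor_lift \<alpha> \<beta> (frag_of (x, y)) = frag_of (\<alpha> x, \<beta> y)"
  by (simp add: tensor_lift_def)

lemma tensor_lift_0 [simp]: "tensor_lift \<alpha> \<beta> 0 = 0"
  by (simp add: tensor_lift_def)

lemma tensor_lift_diff: "tensor_lift \<alpha> \<beta> (a - b) = tensor_lift \<alpha> \<beta> a - tensor_lift \<alpha> \<beta> b"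
  by (simp add: tensor_lift_def frag_extend_diff)

lemma tensor_lift_add: "tensor_lift \<alpha> \<beta> (a + b) = tensor_lift \<alpha> \<beta> a + tensor_lift \<alpha> \<beta> b"
  by (simp add: tensor_lift_def frag_extend_add)

lemma tensor_lift_minus: "tensor_lift \<alpha> \<beta> (- a) = - tensor_lift \<alpha> \<beta> a"
  by (simp add: tensor_lift_def frag_extend_minus)

lemma tensor_lift_compose:
  "tensor_lift \<alpha> \<beta> (tensor_lift \<gamma> \<delta> a) = tensor_lift (\<alpha> \<circ> \<gamma>) (\<beta> \<circ> \<delta>) a"
  using subset_UNIV
  by (induction a rule: frag_induction) (auto simp: tensor_lift_diff)

lemma keys_tensor_lift:
  assumes "Poly_Mapping.keys a \<subseteq> A \<times> B" "\<alpha> ` A \<subseteq> C" "\<beta> ` B \<subseteq> D"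
  shows "Poly_Mapping.keys (tensor_lift \<alpha> \<beta> a) \<subseteq> C \<times> D"
proof -
  have "Poly_Mapping.keys (tensor_lift \<alpha> \<beta> a)
      \<subseteq> (\<Union>z \<in> Poly_Mapping.keys a. Poly_Mapping.keys ((\<lambda>(x, y). frag_of (\<alpha> x, \<beta> y)) z))"
    unfolding tensor_lift_def by (rule keys_frag_extend)
  also have "\<dots> \<subseteq> C \<times> D"
    using assms by (fastforce split: prod.splits)
  finally show ?thesis .
qed

text \<open>
  The generators of the subgroup \<open>tensor_relations\<close>.
\<close>

definition bilinearity_relators ::
  "('a, 'm) monoid_scheme \<Rightarrow> ('b, 'n) monoid_scheme \<Rightarrow> ('a \<times> 'b \<Rightarrow>\<^sub>0 int) set" where
  "bilinearity_relators M N =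
      {frag_of (x \<otimes>\<^bsub>M\<^esub> x', y) - frag_of (x, y) - frag_of (x', y) | x x' y.
         x \<in> carrier M \<and> x' \<in> carrier M \<and> y \<in> carrier N} \<union>
      {frag_of (x, y \<otimes>\<^bsub>N\<^esub> y') - frag_of (x, y) - frag_of (x, y') | x y y'.
         x \<in> carrier M \<and> y \<in> carrier N \<and> y' \<in> carrier N}"

lemma tensor_relations_eq:
  "tensor_relations M N =
    generate (free_Abelian_group (carrier M \<times> carrier N)) (bilinearity_relators M N)"
  by (simp add: tensor_relations_def bilinearity_relators_def)

lemma keys_bilinearity_relators:
  assumes "monoid M" "monoid N" "r \<in> bilinearity_relators M N"
  shows "Poly_Mapping.keys r \<subseteq> carrier M \<times> carrier N"
proof -
  interpret M: monoid M by fact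
  interpret N: monoid N by fact
  have k: "Poly_Mapping.keys (frag_of u - frag_of v - frag_of w) \<subseteq> {u, v, w}"
    for u v w :: "'a \<times> 'c"
    using keys_diff[of "frag_of u - frag_of v" "frag_of w"] keys_diff[of "frag_of u" "frag_of v"]
    by auto
  from assms(3) show ?thesis
    unfolding bilinearity_relators_def by (auto dest!: subsetD[OF k])
qed

lemma subgroup_tensor_relations:
  assumes "monoid M" "monoid N"
  shows "subgroup (tensor_relations M N) (free_Abelian_group (carrier M \<times> carrier N))"
  unfolding tensor_relations_eq
  by (rule group.generate_is_subgroup) (auto dest: keys_bilinearity_relators[OF assms])

lemma keys_tensor_relations:
  assumes "monoid M" "monoid N" "a \<in> tensor_relations M N"
  shows "Poly_Mapping.keys a \<subseteq> carrier M \<times> carrier N"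
  using subgroup.subset[OF subgroup_tensor_relations[OF assms(1,2)]] assms(3)
  by (meson subsetD carrier_free_Abelian_group_iff)

lemma tensor_relations_0: "0 \<in> tensor_relations M N"
  unfolding tensor_relations_eq
  using generate.one[of "free_Abelian_group (carrier M \<times> carrier N)"] by simp

lemma tensor_relations_add:
  "a \<in> tensor_relations M N \<Longrightarrow> b \<in> tensor_relations M N \<Longrightarrow> a + b \<in> tensor_relations M N"
  unfolding tensor_relations_eq
  using generate.eng[of a "free_Abelian_group (carrier M \<times> carrier N)"] by simp

lemma tensor_relations_minus:
  assumes "monoid M" "monoid N" "a \<in> tensor_relations M N"
  shows "- a \<in> tensor_relations M N"
  using subgroup.m_inv_closed[OF subgroup_tensor_relations[OF assms(1,2)] assms(3)]
    keys_tensor_relations[OF assms] by simp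

lemma tensor_relations_diff:
  assumes "monoid M" "monoid N" "a \<in> tensor_relations M N" "b \<in> tensor_relations M N"
  shows "a - b \<in> tensor_relations M N"
  using tensor_relations_add[OF assms(3) tensor_relations_minus[OF assms(1,2,4)]] by simp

lemma tensor_relations_left:
  "x \<in> carrier M \<Longrightarrow> x' \<in> carrier M \<Longrightarrow> y \<in> carrier N \<Longrightarrow>
   frag_of (x \<otimes>\<^bsub>M\<^esub> x', y) - frag_of (x, y) - frag_of (x', y) \<in> tensor_relations M N"
  unfolding tensor_relations_eq by (rule generate.incl) (auto simp: bilinearity_relators_def)

lemma tensor_relations_right:
  "x \<in> carrier M \<Longrightarrow> y \<in> carrier N \<Longrightarrow> y' \<in> carrier N \<Longrightarrow>
   frag_of (x, y \<otimes>\<^bsub>N\<^esub> y') - frag_of (x, y) - frag_of (x, y') \<in> tensor_relations M N"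
  unfolding tensor_relations_eq by (rule generate.incl) (auto simp: bilinearity_relators_def)

lemma tensor_relations_induct [consumes 3, case_names zero add minus left right]:
  assumes "monoid M" "monoid N" "a \<in> tensor_relations M N"
    and "P 0"
    and "\<And>a b. P a \<Longrightarrow> P b \<Longrightarrow> P (a + b)"
    and "\<And>a. P a \<Longrightarrow> P (- a)"
    and l: "\<And>x x' y. x \<in> carrier M \<Longrightarrow> x' \<in> carrier M \<Longrightarrow> y \<in> carrier N \<Longrightarrow>
          P (frag_of (x \<otimes>\<^bsub>M\<^esub> x', y) - frag_of (x, y) - frag_of (x', y))"
    and r: "\<And>x y y'. x \<in> carrier M \<Longrightarrow> y \<in> carrier N \<Longrightarrow> y' \<in> carrier N \<Longrightarrow>
          P (frag_of (x, y \<otimes>\<^bsub>N\<^esub> y') - frag_of (x, y) - frag_of (x, y'))"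
  shows "P a"
  using assms(3) unfolding tensor_relations_eq
proof (induction a rule: generate.induct)
  case one
  then show ?case using assms(4) by simp
next
  case (incl h)
  then show ?case using l r unfolding bilinearity_relators_def by blast
next
  case (inv h)
  then have "P h" using l r unfolding bilinearity_relators_def by blast
  then show ?case
    using inv keys_bilinearity_relators[OF assms(1,2)] assms(6) by simp
next
  case (eng a b)
  then show ?case using assms(5) by simp
qed

lemma tensor_lift_relations:
  assumes "monoid M" "monoid N" "monoid M'" "monoid N'"
    and \<alpha>: "\<alpha> \<in> hom M M'" and \<beta>: "\<beta> \<in> hom N N'"
    and a: "a \<in> tensor_relations M N"
  shows "tensor_lift \<alpha> \<beta> a \<in> tensor_relations M' N'"
  using assms(1,2) a
proof (induction a rule: tensor_relations_induct)
  case zero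
  then show ?case by (simp add: tensor_relations_0)
next
  case (add a b)
  then show ?case by (simp add: tensor_lift_add tensor_relations_add)
next
  case (minus a)
  then show ?case using assms by (simp add: tensor_lift_minus tensor_relations_minus)
next
  case (left x x' y)
  then show ?case
    using tensor_relations_left[of "\<alpha> x" M' "\<alpha> x'" "\<beta> y" N'] \<alpha> \<beta>
    by (simp add: tensor_lift_diff hom_mult hom_in_carrier)
next
  case (right x y y')
  then show ?case
    using tensor_relations_right[of "\<alpha> x" M' "\<beta> y" N' "\<beta> y'"] \<alpha> \<beta>
    by (simp add: tensor_lift_diff hom_mult hom_in_carrier)
qed

lemma tensor_coset_eq_iff:
  fixes M N
  assumes "monoid M" "monoid N"
    and "Poly_Mapping.keys a \<subseteq> carrier M \<times> carrier N" "Poly_Mapping.keys b \<subseteq> carrier M \<times> carrier N"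
  defines "F \<equiv> free_Abelian_group (carrier M \<times> carrier N)"
  shows "tensor_relations M N #>\<^bsub>F\<^esub> a = tensor_relations M N #>\<^bsub>F\<^esub> b
    \<longleftrightarrow> a - b \<in> tensor_relations M N"
proof
  assume "tensor_relations M N #>\<^bsub>F\<^esub> a = tensor_relations M N #>\<^bsub>F\<^esub> b"
  moreover have "a \<in> tensor_relations M N #>\<^bsub>F\<^esub> a"
    unfolding r_coset_def F_def using tensor_relations_0[of M N] by force
  ultimately show "a - b \<in> tensor_relations M N"
    unfolding r_coset_def F_def by auto
next
  assume ab: "a - b \<in> tensor_relations M N"
  have "\<exists>s\<in>tensor_relations M N. r + a = s + b" if "r \<in> tensor_relations M N" for r
    using tensor_relations_add[OF that ab] by (intro bexI[of _ "r + (a - b)"]) auto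
  moreover have "\<exists>s\<in>tensor_relations M N. r + b = s + a" if "r \<in> tensor_relations M N" for r
    using tensor_relations_diff[OF assms(1,2) that ab] by (intro bexI[of _ "r - (a - b)"]) auto
  ultimately show "tensor_relations M N #>\<^bsub>F\<^esub> a = tensor_relations M N #>\<^bsub>F\<^esub> b"
    unfolding r_coset_def F_def by auto
qed

lemma tensor_map_coset:
  fixes M :: "('a, 'm) monoid_scheme" and N :: "('b, 'n) monoid_scheme"
    and N' :: "('c, 'k) monoid_scheme"
  assumes "monoid M" "monoid N" "monoid N'" "\<phi> \<in> hom N N'"
  shows "tensor_map M N' \<phi> (tensor_relations M N #>\<^bsub>free_Abelian_group (carrier M \<times> carrier N)\<^esub> a)
    = tensor_relations M N' #>\<^bsub>free_Abelian_group (carrier M \<times> carrier N')\<^esub> tensor_lift id \<phi> a"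
proof -
  have eq: "tensor_map M N' \<phi> X
      = {s + tensor_lift id \<phi> x | s x. s \<in> tensor_relations M N' \<and> x \<in> X}" for X
    unfolding tensor_map_def set_mult_def tensor_lift_def by auto
  have lift: "tensor_lift id \<phi> r \<in> tensor_relations M N'" if "r \<in> tensor_relations M N" for r
    by (rule tensor_lift_relations[OF _ _ _ _ _ _ that]) (use assms in \<open>auto simp: hom_def\<close>)
  show ?thesis
    unfolding eq
  proof (intro equalityI subsetI)
    fix z
    assume "z \<in> {s + tensor_lift id \<phi> x | s x. s \<in> tensor_relations M N' \<and>
        x \<in> tensor_relations M N #>\<^bsub>free_Abelian_group (carrier M \<times> carrier N)\<^esub> a}"
    then obtain s r where s: "s \<in> tensor_relations M N'" and r: "r \<in> tensor_relations M N"
      and z: "z = s + tensor_lift id \<phi> (r + a)"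
      by (auto simp: r_coset_def)
    have "s + tensor_lift id \<phi> r \<in> tensor_relations M N'"
      using s lift[OF r] by (rule tensor_relations_add)
    then show "z \<in> tensor_relations M N' #>\<^bsub>free_Abelian_group (carrier M \<times> carrier N')\<^esub> tensor_lift id \<phi> a"
      by (force simp: r_coset_def z tensor_lift_add add.assoc)
  next
    fix z
    assume "z \<in> tensor_relations M N' #>\<^bsub>free_Abelian_group (carrier M \<times> carrier N')\<^esub> tensor_lift id \<phi> a"
    then obtain s where s: "s \<in> tensor_relations M N'" and z: "z = s + tensor_lift id \<phi> a"
      by (auto simp: r_coset_def)
    moreover have "a \<in> tensor_relations M N #>\<^bsub>free_Abelian_group (carrier M \<times> carrier N)\<^esub> a"
      using tensor_relations_0[of M N] by (force simp: r_coset_def)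
    ultimately show "z \<in> {s + tensor_lift id \<phi> x | s x. s \<in> tensor_relations M N' \<and>
        x \<in> tensor_relations M N #>\<^bsub>free_Abelian_group (carrier M \<times> carrier N)\<^esub> a}"
      by blast
  qed
qed

text \<open>
  Flatness in terms of representatives: an element of the free abelian group that becomes a relation
  under \<open>id \<otimes> \<phi>\<close> already is one.  This avoids cosets in all that follows.
\<close>

lemma flat_abelian_group_iff:
  fixes M :: "('a, 'm) monoid_scheme"
  assumes M: "monoid M"
  shows "flat_abelian_group M \<longleftrightarrow>
     (\<forall>(N :: int monoid) (N' :: int monoid) \<phi>.
        comm_group N \<longrightarrow> comm_group N' \<longrightarrow> \<phi> \<in> mon N N' \<longrightarrow>
        (\<forall>a. Poly_Mapping.keys a \<subseteq> carrier M \<times> carrier N \<longrightarrow>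
             tensor_lift id \<phi> a \<in> tensor_relations M N' \<longrightarrow> a \<in> tensor_relations M N))"
proof -
  have "inj_on (tensor_map M N' \<phi>) (carrier (tensor M N)) \<longleftrightarrow>
        (\<forall>a. Poly_Mapping.keys a \<subseteq> carrier M \<times> carrier N \<longrightarrow>
             tensor_lift id \<phi> a \<in> tensor_relations M N' \<longrightarrow> a \<in> tensor_relations M N)"
    (is "?inj \<longleftrightarrow> ?ker")
    if N: "comm_group N" and N': "comm_group N'" and \<phi>: "\<phi> \<in> mon N N'"
    for N N' :: "int monoid" and \<phi>
  proof -
    let ?F = "free_Abelian_group (carrier M \<times> carrier N)"
    let ?F' = "free_Abelian_group (carrier M \<times> carrier N')"
    have mN: "monoid N" and mN': "monoid N'"
      using N N' by (auto simp: comm_group_def comm_monoid_def)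
    have h: "\<phi> \<in> hom N N'"
      using \<phi> by (simp add: mon_def)
    have carr: "carrier (tensor M N)
        = (\<lambda>a. tensor_relations M N #>\<^bsub>?F\<^esub> a) ` {a. Poly_Mapping.keys a \<subseteq> carrier M \<times> carrier N}"
      by (auto simp: tensor_def carrier_FactGroup)
    have keys: "Poly_Mapping.keys (tensor_lift id \<phi> a) \<subseteq> carrier M \<times> carrier N'"
      if "Poly_Mapping.keys a \<subseteq> carrier M \<times> carrier N" for a
      by (rule keys_tensor_lift[OF that]) (use h in \<open>auto simp: hom_in_carrier\<close>)
    note map = tensor_map_coset[OF M mN mN' h]
    note eq = tensor_coset_eq_iff[OF M mN] and eq' = tensor_coset_eq_iff[OF M mN']
    show ?thesis
    proof
      assume inj: ?inj
      show ?ker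
      proof (intro allI impI)
        fix a :: "'a \<times> int \<Rightarrow>\<^sub>0 int"
        assume a: "Poly_Mapping.keys a \<subseteq> carrier M \<times> carrier N"
          and 0: "tensor_lift id \<phi> a \<in> tensor_relations M N'"
        have "tensor_map M N' \<phi> (tensor_relations M N #>\<^bsub>?F\<^esub> a)
            = tensor_map M N' \<phi> (tensor_relations M N #>\<^bsub>?F\<^esub> 0)"
          unfolding map using eq'[OF keys[OF a], of 0] 0 by simp
        then have "tensor_relations M N #>\<^bsub>?F\<^esub> a = tensor_relations M N #>\<^bsub>?F\<^esub> 0"
          by (rule inj_onD[OF inj]) (use a in \<open>auto simp: carr\<close>)
        then show "a \<in> tensor_relations M N"
          using eq[OF a, of 0] by simp
      qed
    next
      assume ker: ?ker
      show ?inj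
        unfolding carr
      proof (rule inj_onI, clarify)
        fix a b :: "'a \<times> int \<Rightarrow>\<^sub>0 int"
        assume a: "Poly_Mapping.keys a \<subseteq> carrier M \<times> carrier N"
          and b: "Poly_Mapping.keys b \<subseteq> carrier M \<times> carrier N"
          and ab: "tensor_map M N' \<phi> (tensor_relations M N #>\<^bsub>?F\<^esub> a)
            = tensor_map M N' \<phi> (tensor_relations M N #>\<^bsub>?F\<^esub> b)"
        have "tensor_lift id \<phi> (a - b) \<in> tensor_relations M N'"
          using ab unfolding map eq'[OF keys[OF a] keys[OF b]] by (simp add: tensor_lift_diff)
        moreover have "Poly_Mapping.keys (a - b) \<subseteq> carrier M \<times> carrier N"
          using keys_diff[of a b] a b by blast
        ultimately show "tensor_relations M N #>\<^bsub>?F\<^esub> a = tensor_relations M N #>\<^bsub>?F\<^esub> b"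
          using ker eq[OF a b] by blast
      qed
    qed
  qed
  then show ?thesis
    unfolding flat_abelian_group_def by (intro iff_allI imp_cong refl)
qed

text \<open>
  If the identity of \<open>M'\<close> is a sum of two maps that factor through \<open>M\<close>, as for \<open>M' = M \<oplus> M\<close>, then
  \<open>M'\<close> inherits flatness: an element of \<open>M' \<otimes> N\<close> in the kernel has both components in the kernel
  for \<open>M\<close>, and modulo relations it is the sum of the images of its components.
\<close>

lemma flat_abelian_group_biproduct:
  fixes M :: "('a, 'm) monoid_scheme" and M' :: "('b, 'n) monoid_scheme"
  assumes M: "comm_group M" and M': "comm_group M'"
    and hom: "\<pi>\<^sub>1 \<in> hom M' M" "\<pi>\<^sub>2 \<in> hom M' M" "\<iota>\<^sub>1 \<in> hom M M'" "\<iota>\<^sub>2 \<in> hom M M'"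
    and sum: "\<And>x. x \<in> carrier M' \<Longrightarrow> x = \<iota>\<^sub>1 (\<pi>\<^sub>1 x) \<otimes>\<^bsub>M'\<^esub> \<iota>\<^sub>2 (\<pi>\<^sub>2 x)"
    and flat: "flat_abelian_group M"
  shows "flat_abelian_group M'"
proof -
  have mM: "monoid M" and mM': "monoid M'"
    using M M' by (auto simp: comm_group_def comm_monoid_def)
  show ?thesis
    unfolding flat_abelian_group_iff[OF mM']
  proof (intro allI impI)
    fix N N' :: "int monoid" and \<phi> and a :: "'b \<times> int \<Rightarrow>\<^sub>0 int"
    assume N: "comm_group N" and N': "comm_group N'" and \<phi>: "\<phi> \<in> mon N N'"
      and a: "Poly_Mapping.keys a \<subseteq> carrier M' \<times> carrier N"
      and 0: "tensor_lift id \<phi> a \<in> tensor_relations M' N'"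
    have mN: "monoid N" and mN': "monoid N'"
      using N N' by (auto simp: comm_group_def comm_monoid_def)
    have id: "id \<in> hom K K" for K :: "int monoid"
      by (auto simp: hom_def)
    have component: "tensor_lift \<iota> id (tensor_lift \<pi> id a) \<in> tensor_relations M' N"
      if \<pi>: "\<pi> \<in> hom M' M" and \<iota>: "\<iota> \<in> hom M M'" for \<pi> \<iota>
    proof -
      have "tensor_lift id \<phi> (tensor_lift \<pi> id a) = tensor_lift \<pi> id (tensor_lift id \<phi> a)"
        by (simp add: tensor_lift_compose)
      also have "\<dots> \<in> tensor_relations M N'"
        by (rule tensor_lift_relations[OF mM' mN' mM mN' \<pi> id 0])
      finally have "tensor_lift \<pi> id a \<in> tensor_relations M N"
        using flat[unfolded flat_abelian_group_iff[OF mM]] N N' \<phi>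
          keys_tensor_lift[OF a, of \<pi> "carrier M" id "carrier N"] hom_in_carrier[OF \<pi>]
        by (auto simp: image_subset_iff)
      then show ?thesis
        by (rule tensor_lift_relations[OF mM mN mM' mN \<iota> id])
    qed
    define t where "t = tensor_lift \<iota>\<^sub>1 id (tensor_lift \<pi>\<^sub>1 id a) + tensor_lift \<iota>\<^sub>2 id (tensor_lift \<pi>\<^sub>2 id a)"
    have "a - t \<in> tensor_relations M' N"
      using a unfolding t_def
    proof (induction a rule: frag_induction)
      case zero
      then show ?case by (simp add: tensor_relations_0)
    next
      case (one z)
      then obtain x y where z: "z = (x, y)" and x: "x \<in> carrier M'" and y: "y \<in> carrier N"
        by auto
      have "frag_of (\<iota>\<^sub>1 (\<pi>\<^sub>1 x) \<otimes>\<^bsub>M'\<^esub> \<iota>\<^sub>2 (\<pi>\<^sub>2 x), y) - frag_of (\<iota>\<^sub>1 (\<pi>\<^sub>1 x), y)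
          - frag_of (\<iota>\<^sub>2 (\<pi>\<^sub>2 x), y) \<in> tensor_relations M' N"
        by (rule tensor_relations_left) (use hom x y in \<open>auto simp: hom_def\<close>)
      then show ?case
        using sum[OF x] by (simp add: z diff_diff_eq)
    next
      case (diff a b)
      from tensor_relations_diff[OF mM' mN diff] show ?case
        by (simp add: tensor_lift_diff algebra_simps)
    qed
    moreover have "t \<in> tensor_relations M' N"
      unfolding t_def using component hom by (blast intro: tensor_relations_add)
    ultimately have "(a - t) + t \<in> tensor_relations M' N"
      by (rule tensor_relations_add)
    then show "a \<in> tensor_relations M' N" by simp
  qed
qed

text \<open>
  Flatness is applied to multiplication by \<open>n\<close> on \<open>\<int>\<close>, which sends \<open>x \<otimes> 1\<close> to \<open>x \<otimes> n = x\<^sup>n \<otimes> 1\<close>.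
\<close>

lemma flat_abelian_group_torsion_free:
  fixes M :: "('a, 'm) monoid_scheme" and n :: nat
  assumes M: "comm_group M" and flat: "flat_abelian_group M"
    and x: "x \<in> carrier M" and n: "n > 0" and xn: "x [^]\<^bsub>M\<^esub> n = \<one>\<^bsub>M\<^esub>"
  shows "x = \<one>\<^bsub>M\<^esub>"
proof -
  interpret M: comm_group M by fact
  define Z :: "int monoid" where "Z = \<lparr>carrier = UNIV, monoid.mult = (+), one = 0\<rparr>"
  have Z_simps: "carrier Z = UNIV" "y \<otimes>\<^bsub>Z\<^esub> z = y + z" for y z
    by (simp_all add: Z_def)
  have Z: "comm_group Z"
    by (rule comm_groupI) (auto simp: Z_def intro: exI[of _ "- _"])
  then have mZ: "monoid Z"
    by (simp add: comm_group_def comm_monoid_def)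
  have \<phi>: "(*) (int n) \<in> mon Z Z"
    using n by (auto simp: mon_def hom_def Z_def inj_on_def distrib_left)
  let ?T = "tensor_relations M Z"
  note add = tensor_relations_add[of _ M Z] and diff = tensor_relations_diff[OF M.monoid_axioms mZ]
  have "- frag_of (x, 0 :: int) \<in> ?T"
    using tensor_relations_right[of x M 0 Z 0] x by (simp add: Z_simps)
  then have x0: "frag_of (x, 0) \<in> ?T"
    using tensor_relations_minus[OF M.monoid_axioms mZ] by fastforce
  have "- frag_of (\<one>\<^bsub>M\<^esub>, 1 :: int) \<in> ?T"
    using tensor_relations_left[of "\<one>\<^bsub>M\<^esub>" M "\<one>\<^bsub>M\<^esub>" 1 Z] by (simp add: Z_simps)
  then have one1: "frag_of (\<one>\<^bsub>M\<^esub>, 1) \<in> ?T"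
    using tensor_relations_minus[OF M.monoid_axioms mZ] by fastforce
  have "frag_of (x, int k) - frag_of (x [^]\<^bsub>M\<^esub> k, 1) \<in> ?T" for k
  proof (induction k)
    case 0
    show ?case using diff[OF x0 one1] by simp
  next
    case (Suc k)
    have "frag_of (x, int k + 1) - frag_of (x, int k) - frag_of (x, 1) \<in> ?T"
      using tensor_relations_right[of x M "int k" Z 1] x by (simp add: Z_simps)
    moreover have "frag_of (x [^]\<^bsub>M\<^esub> k \<otimes>\<^bsub>M\<^esub> x, 1) - frag_of (x [^]\<^bsub>M\<^esub> k, 1) - frag_of (x, 1) \<in> ?T"
      using tensor_relations_left[of "x [^]\<^bsub>M\<^esub> k" M x 1 Z] x by (simp add: Z_simps)
    ultimately have "(frag_of (x, int k + 1) - frag_of (x, int k) - frag_of (x, 1))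
       - (frag_of (x [^]\<^bsub>M\<^esub> k \<otimes>\<^bsub>M\<^esub> x, 1) - frag_of (x [^]\<^bsub>M\<^esub> k, 1) - frag_of (x, 1)) \<in> ?T"
      by (rule diff)
    from add[OF this Suc] show ?case
      by (simp add: algebra_simps)
  qed
  from this[of n] have "frag_of (x, int n) - frag_of (\<one>\<^bsub>M\<^esub>, 1) \<in> ?T"
    by (simp add: xn)
  from add[OF this one1] have "tensor_lift id ((*) (int n)) (frag_of (x, 1)) \<in> ?T"
    by simp
  then have x1: "frag_of (x, 1) \<in> ?T"
    using flat[unfolded flat_abelian_group_iff[OF M.monoid_axioms]] Z \<phi> x by (simp add: Z_simps)
  \<comment> \<open>The evaluation \<open>(y, k) \<mapsto> y\<^sup>k\<close> kills the relations, so it detects \<open>x \<otimes> 1\<close>.\<close>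
  have "(\<lambda>(y, k). y [^]\<^bsub>M\<^esub> (k :: int)) ` (carrier M \<times> carrier Z) \<subseteq> carrier M"
    by auto
  then obtain h where h: "h \<in> hom (free_Abelian_group (carrier M \<times> carrier Z)) M"
    and hof: "\<And>z. z \<in> carrier M \<times> carrier Z \<Longrightarrow> h (frag_of z) = (\<lambda>(y, k). y [^]\<^bsub>M\<^esub> (k :: int)) z"
    by (rule M.free_Abelian_group_universal) blast
  interpret h: group_hom "free_Abelian_group (carrier M \<times> carrier Z)" M h
    using h by (simp add: group_hom_def group_hom_axioms_def)
  have hdiff: "h (a - b) = h a \<otimes>\<^bsub>M\<^esub> inv\<^bsub>M\<^esub> h b"
    if "Poly_Mapping.keys a \<subseteq> carrier M \<times> carrier Z" "Poly_Mapping.keys b \<subseteq> carrier M \<times> carrier Z"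
    for a b
    using h.hom_mult[of a "- b"] h.hom_inv[of b] that by simp
  have "bilinearity_relators M Z \<subseteq> kernel (free_Abelian_group (carrier M \<times> carrier Z)) M h"
  proof
    fix r
    assume r: "r \<in> bilinearity_relators M Z"
    have keys2: "Poly_Mapping.keys (frag_of u - frag_of v) \<subseteq> carrier M \<times> carrier Z"
      if "u \<in> carrier M \<times> carrier Z" "v \<in> carrier M \<times> carrier Z" for u v :: "'a \<times> int"
      using keys_diff[of "frag_of u" "frag_of v"] that by auto
    have h3: "h (frag_of u - frag_of v - frag_of w) = \<one>\<^bsub>M\<^esub>"
      if "u \<in> carrier M \<times> carrier Z" "v \<in> carrier M \<times> carrier Z" "w \<in> carrier M \<times> carrier Z"
        "h (frag_of u) = h (frag_of v) \<otimes>\<^bsub>M\<^esub> h (frag_of w)" for u v w :: "'a \<times> int"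
    proof -
      have "h (frag_of v) \<in> carrier M" "h (frag_of w) \<in> carrier M"
        using that by (auto intro!: h.hom_closed)
      then have "h (frag_of v) \<otimes>\<^bsub>M\<^esub> h (frag_of w) \<otimes>\<^bsub>M\<^esub> inv\<^bsub>M\<^esub> h (frag_of v)
        \<otimes>\<^bsub>M\<^esub> inv\<^bsub>M\<^esub> h (frag_of w) = \<one>\<^bsub>M\<^esub>"
        by (metis M.inv_closed M.m_closed M.m_comm M.inv_solve_right' M.r_inv M.m_assoc)
      then show ?thesis
        using that keys2[OF that(1,2)] by (simp add: hdiff)
    qed
    have "h r = \<one>\<^bsub>M\<^esub>"
      using r unfolding bilinearity_relators_def
      by (auto simp: Z_simps hof M.int_pow_mult M.int_pow_distrib intro!: h3)
    then show "r \<in> kernel (free_Abelian_group (carrier M \<times> carrier Z)) M h"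
      using keys_bilinearity_relators[OF M.monoid_axioms mZ r] by (simp add: kernel_def)
  qed
  then have "?T \<subseteq> kernel (free_Abelian_group (carrier M \<times> carrier Z)) M h"
    unfolding tensor_relations_eq
    by (rule group.generate_subgroup_incl[OF group_free_Abelian_group _ h.subgroup_kernel])
  with x1 have "h (frag_of (x, 1)) = \<one>\<^bsub>M\<^esub>"
    by (auto simp: kernel_def)
  then show ?thesis
    using x by (simp add: hof Z_simps)
qed

lemma fppf_cover_torsion_free:
  fixes R (structure)
  assumes R: "fppf_cover R" and x: "x \<in> carrier R" and k: "k \<noteq> 0"
    and 0: "of_int_ring R k \<otimes>\<^bsub>R\<^esub> x = \<zero>\<^bsub>R\<^esub>"
  shows "x = \<zero>\<^bsub>R\<^esub>"
proof -
  interpret cring R using R by (simp add: fppf_cover_def)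
  have kx: "add_pow R k x = \<zero>"
    using 0 x by (simp add: of_int_ring_def add_pow_ldistr_int)
  have "add_pow R (nat \<bar>k\<bar>) x = \<zero>"
  proof (cases "k \<ge> 0")
    case True
    then show ?thesis using kx by (simp add: add_pow_int_ge)
  next
    case False
    then show ?thesis
      using kx x add_pow_int_lt[of k R x] by (metis abs_of_neg add.inv_eq_1_iff add.nat_pow_closed not_le)
  qed
  then show ?thesis
    using flat_abelian_group_torsion_free[of "add_monoid R" x "nat \<bar>k\<bar>"] R x k a_comm_group
    by (simp add: fppf_cover_def add_pow_def)
qed

text \<open>
  After division by the greatest common divisor, \<open>a\<close> and \<open>b\<close> are coprime.  A prime number dividing
  one of them lies under a prime ideal of \<open>R\<close>, and since \<open>u\<close> is a unit it divides the other as well.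
\<close>

lemma fppf_cover_associated:
  fixes R (structure) and a b :: int
  assumes R: "fppf_cover R" and u: "u \<in> Units R" and a: "a \<noteq> 0"
    and eq: "of_int_ring R a = u \<otimes>\<^bsub>R\<^esub> of_int_ring R b"
  shows "a = b \<or> a = - b"
proof -
  interpret cring R using R by (simp add: fppf_cover_def)
  interpret I: ring_hom_ring \<Z> R "of_int_ring R" by (rule of_int_ring_hom_ring)
  have [simp]: "of_int_ring R k \<in> carrier R" for k by (rule I.hom_closed) simp
  have Imult: "of_int_ring R (k * l) = of_int_ring R k \<otimes> of_int_ring R l" for k l
    using I.hom_mult[of k l] by simp
  have [simp]: "u \<in> carrier R" using u by blast
  define g where "g = gcd a b"
  define a' b' where "a' = a div g" and "b' = b div g"
  have g: "g \<noteq> 0" and ab: "a = g * a'" "b = g * b'" and co: "coprime a' b'"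
    using a by (auto simp: g_def a'_def b'_def div_gcd_coprime)
  have "of_int_ring R g \<otimes> (of_int_ring R a' \<ominus> u \<otimes> of_int_ring R b')
      = of_int_ring R a \<ominus> u \<otimes> of_int_ring R b"
    unfolding ab Imult by (simp add: minus_eq r_distr r_minus m_lcomm)
  also have "\<dots> = \<zero>"
    using eq by simp
  finally have "of_int_ring R a' \<ominus> u \<otimes> of_int_ring R b' = \<zero>"
    using fppf_cover_torsion_free[OF R _ g] by simp
  then have eq': "of_int_ring R a' = u \<otimes> of_int_ring R b'"
    by simp
  have unit: "\<bar>c\<bar> = 1"
    if co: "coprime c e" and v: "v \<in> Units R" and cv: "of_int_ring R c = v \<otimes> of_int_ring R e"
    for c e v
  proof (rule ccontr)
    assume "\<bar>c\<bar> \<noteq> 1"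
    then obtain p where p: "prime p" "p dvd c"
      using prime_factor_int by blast
    then obtain Q where Q: "primeideal Q R" "of_int_ring R -` Q = Idl\<^bsub>\<Z>\<^esub> {p}"
      using R prime_primeideal[OF p(1)] unfolding fppf_cover_def spec_surjective_def by blast
    interpret Q: primeideal Q R by fact
    have mem: "of_int_ring R k \<in> Q \<longleftrightarrow> p dvd k" for k
      using Q(2) by (auto simp: int_Idl dvd_def mult.commute)
    have vc: "v \<in> carrier R" using v by blast
    have "inv v \<otimes> of_int_ring R c \<in> Q"
      using p(2) mem v by (simp add: Q.I_l_closed)
    also have "inv v \<otimes> of_int_ring R c = of_int_ring R e"
      using v vc by (simp add: cv m_assoc[symmetric])
    finally have "p dvd e" using mem by simp
    with p co show False
      by (meson coprime_common_divisor not_prime_unit)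
  qed
  have "of_int_ring R b' = inv u \<otimes> of_int_ring R a'"
    using u by (simp add: eq' m_assoc[symmetric])
  then have "\<bar>b'\<bar> = 1"
    using unit[of b' a' "inv u"] u co by (simp add: coprime_commute)
  moreover have "\<bar>a'\<bar> = 1"
    using unit[OF co u eq'] .
  ultimately show ?thesis
    unfolding ab by (metis abs_eq_iff mult_minus_right minus_minus)
qed

section \<open>Adjoining a square root of minus one\<close>

text \<open>
  The element \<open>x + \<i> y\<close> of \<open>R[\<i>]\<close>.  Pairs of natural numbers are encoded as natural numbers, so that
  \<open>R[\<i>]\<close> has its carrier in \<open>nat\<close> like \<open>R\<close>.
\<close>

definition gauss :: "nat \<Rightarrow> nat \<Rightarrow> nat" where
  "gauss x y = prod_encode (x, y)"

text \<open>
  Every natural number encodes a pair, so the coordinates are also defined outside the carrier.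
\<close>

definition gauss_re :: "nat \<Rightarrow> nat" where
  "gauss_re z = fst (prod_decode z)"

definition gauss_im :: "nat \<Rightarrow> nat" where
  "gauss_im z = snd (prod_decode z)"

lemma gauss_re_gauss [simp]: "gauss_re (gauss x y) = x"
  and gauss_im_gauss [simp]: "gauss_im (gauss x y) = y"
  by (simp_all add: gauss_def gauss_re_def gauss_im_def)

lemma gauss_collapse [simp]: "gauss (gauss_re z) (gauss_im z) = z"
  by (simp add: gauss_def gauss_re_def gauss_im_def)

lemma gauss_eq_iff [simp]: "gauss x y = gauss x' y' \<longleftrightarrow> x = x' \<and> y = y'"
  by (simp add: gauss_def)

text \<open>
  The ring \<open>R[\<i>] = R[X] / (X\<^sup>2 + 1)\<close>.
\<close>

definition gauss_ring :: "(nat, 'm) ring_scheme \<Rightarrow> nat ring" where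
  "gauss_ring R =
    \<lparr>carrier = {gauss x y | x y. x \<in> carrier R \<and> y \<in> carrier R},
     monoid.mult = (\<lambda>z w.
       gauss (gauss_re z \<otimes>\<^bsub>R\<^esub> gauss_re w \<ominus>\<^bsub>R\<^esub> gauss_im z \<otimes>\<^bsub>R\<^esub> gauss_im w)
             (gauss_re z \<otimes>\<^bsub>R\<^esub> gauss_im w \<oplus>\<^bsub>R\<^esub> gauss_im z \<otimes>\<^bsub>R\<^esub> gauss_re w)),
     one = gauss \<one>\<^bsub>R\<^esub> \<zero>\<^bsub>R\<^esub>,
     zero = gauss \<zero>\<^bsub>R\<^esub> \<zero>\<^bsub>R\<^esub>,
     add = (\<lambda>z w. gauss (gauss_re z \<oplus>\<^bsub>R\<^esub> gauss_re w) (gauss_im z \<oplus>\<^bsub>R\<^esub> gauss_im w))\<rparr>"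

lemma gauss_ring_simps:
  "gauss x y \<in> carrier (gauss_ring R) \<longleftrightarrow> x \<in> carrier R \<and> y \<in> carrier R"
  "gauss x y \<otimes>\<^bsub>gauss_ring R\<^esub> gauss x' y' =
     gauss (x \<otimes>\<^bsub>R\<^esub> x' \<ominus>\<^bsub>R\<^esub> y \<otimes>\<^bsub>R\<^esub> y') (x \<otimes>\<^bsub>R\<^esub> y' \<oplus>\<^bsub>R\<^esub> y \<otimes>\<^bsub>R\<^esub> x')"
  "\<one>\<^bsub>gauss_ring R\<^esub> = gauss \<one>\<^bsub>R\<^esub> \<zero>\<^bsub>R\<^esub>"
  "\<zero>\<^bsub>gauss_ring R\<^esub> = gauss \<zero>\<^bsub>R\<^esub> \<zero>\<^bsub>R\<^esub>"
  "gauss x y \<oplus>\<^bsub>gauss_ring R\<^esub> gauss x' y' = gauss (x \<oplus>\<^bsub>R\<^esub> x') (y \<oplus>\<^bsub>R\<^esub> y')"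
  by (auto simp: gauss_ring_def)

lemma carrier_gauss_ring:
  "z \<in> carrier (gauss_ring R) \<longleftrightarrow> (\<exists>x\<in>carrier R. \<exists>y\<in>carrier R. z = gauss x y)"
  by (auto simp: gauss_ring_def)

lemma carrier_gauss_ringE:
  assumes "z \<in> carrier (gauss_ring R)"
  obtains x y where "z = gauss x y" "x \<in> carrier R" "y \<in> carrier R"
  using assms by (auto simp: gauss_ring_def)

text \<open>
  Associativity of the multiplication of \<open>R[\<i>]\<close>, in real and imaginary parts.
\<close>

lemma (in cring) gauss_mult_assoc:
  assumes "x \<in> carrier R" "y \<in> carrier R" "x' \<in> carrier R" "y' \<in> carrier R"
    "x'' \<in> carrier R" "y'' \<in> carrier R"
  shows "(x \<otimes> x' \<ominus> y \<otimes> y') \<otimes> x'' \<ominus> (x \<otimes> y' \<oplus> y \<otimes> x') \<otimes> y''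
      = x \<otimes> (x' \<otimes> x'' \<ominus> y' \<otimes> y'') \<ominus> y \<otimes> (x' \<otimes> y'' \<oplus> y' \<otimes> x'')"
    and "(x \<otimes> x' \<ominus> y \<otimes> y') \<otimes> y'' \<oplus> (x \<otimes> y' \<oplus> y \<otimes> x') \<otimes> x''
      = x \<otimes> (x' \<otimes> y'' \<oplus> y' \<otimes> x'') \<oplus> y \<otimes> (x' \<otimes> x'' \<ominus> y' \<otimes> y'')"
proof -
  have l: "in_carrier [x, y, x', y', x'', y'']"
    using assms by (simp add: in_carrier_def)
  let ?re = "\<lambda>(x, y) (x', y'). Sub (Mul x x') (Mul y y')"
  let ?im = "\<lambda>(x, y) (x', y'). Add (Mul x y') (Mul y x')"
  let ?m = "\<lambda>z w. (?re z w, ?im z w)"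
  let ?z = "(Var 0, Var 1)" and ?w = "(Var 2, Var 3)" and ?v = "(Var 4, Var 5)"
  have 1: "norm (?re (?m ?z ?w) ?v) = norm (?re ?z (?m ?w ?v))"
    by code_simp
  have 2: "norm (?im (?m ?z ?w) ?v) = norm (?im ?z (?m ?w ?v))"
    by code_simp
  show "(x \<otimes> x' \<ominus> y \<otimes> y') \<otimes> x'' \<ominus> (x \<otimes> y' \<oplus> y \<otimes> x') \<otimes> y''
      = x \<otimes> (x' \<otimes> x'' \<ominus> y' \<otimes> y'') \<ominus> y \<otimes> (x' \<otimes> y'' \<oplus> y' \<otimes> x'')"
    using norm_eq[OF l 1] by simp
  show "(x \<otimes> x' \<ominus> y \<otimes> y') \<otimes> y'' \<oplus> (x \<otimes> y' \<oplus> y \<otimes> x') \<otimes> x''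
      = x \<otimes> (x' \<otimes> y'' \<oplus> y' \<otimes> x'') \<oplus> y \<otimes> (x' \<otimes> x'' \<ominus> y' \<otimes> y'')"
    using norm_eq[OF l 2] by simp
qed

lemma cring_gauss_ring:
  fixes R :: "(nat, 'm) ring_scheme" (structure)
  assumes "cring R"
  shows "cring (gauss_ring R)"
proof -
  interpret cring R by fact
  show ?thesis
  proof (rule cringI)
    show "abelian_group (gauss_ring R)"
    proof (rule abelian_groupI)
      fix z assume "z \<in> carrier (gauss_ring R)"
      then obtain x y where z: "z = gauss x y" "x \<in> carrier R" "y \<in> carrier R"
        by (rule carrier_gauss_ringE)
      show "\<exists>w\<in>carrier (gauss_ring R). w \<oplus>\<^bsub>gauss_ring R\<^esub> z = \<zero>\<^bsub>gauss_ring R\<^esub>"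
        using z by (intro bexI[of _ "gauss (\<ominus> x) (\<ominus> y)"]) (auto simp: gauss_ring_simps l_neg)
    qed (auto elim!: carrier_gauss_ringE simp: gauss_ring_simps a_ac)
    show "comm_monoid (gauss_ring R)"
    proof (rule comm_monoidI)
      fix z w v
      assume "z \<in> carrier (gauss_ring R)" "w \<in> carrier (gauss_ring R)" "v \<in> carrier (gauss_ring R)"
      then obtain x y x' y' x'' y'' where [simp]: "z = gauss x y" "w = gauss x' y'" "v = gauss x'' y''"
        and c: "x \<in> carrier R" "y \<in> carrier R" "x' \<in> carrier R" "y' \<in> carrier R"
          "x'' \<in> carrier R" "y'' \<in> carrier R"
        by (auto simp: carrier_gauss_ring)
      show "z \<otimes>\<^bsub>gauss_ring R\<^esub> w \<otimes>\<^bsub>gauss_ring R\<^esub> v = z \<otimes>\<^bsub>gauss_ring R\<^esub> (w \<otimes>\<^bsub>gauss_ring R\<^esub> v)"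
        using gauss_mult_assoc[OF c] by (simp add: gauss_ring_simps)
    qed (auto elim!: carrier_gauss_ringE simp: gauss_ring_simps m_comm a_comm minus_eq)
    fix z w v
    assume "z \<in> carrier (gauss_ring R)" "w \<in> carrier (gauss_ring R)" "v \<in> carrier (gauss_ring R)"
    then obtain x y x' y' x'' y'' where [simp]: "z = gauss x y" "w = gauss x' y'" "v = gauss x'' y''"
      and c: "x \<in> carrier R" "y \<in> carrier R" "x' \<in> carrier R" "y' \<in> carrier R"
        "x'' \<in> carrier R" "y'' \<in> carrier R"
      by (auto simp: carrier_gauss_ring)
    show "(z \<oplus>\<^bsub>gauss_ring R\<^esub> w) \<otimes>\<^bsub>gauss_ring R\<^esub> v
        = z \<otimes>\<^bsub>gauss_ring R\<^esub> v \<oplus>\<^bsub>gauss_ring R\<^esub> w \<otimes>\<^bsub>gauss_ring R\<^esub> v"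
      using c by (simp add: gauss_ring_simps minus_eq l_distr minus_add a_ac)
  qed
qed

text \<open>
  The inclusion of \<open>R\<close> in \<open>R[\<i>]\<close>.
\<close>

definition gauss_embed :: "(nat, 'm) ring_scheme \<Rightarrow> nat \<Rightarrow> nat" where
  "gauss_embed R x = gauss x \<zero>\<^bsub>R\<^esub>"

lemma gauss_embed_hom:
  fixes R :: "(nat, 'm) ring_scheme" (structure)
  assumes "cring R"
  shows "ring_hom_ring R (gauss_ring R) (gauss_embed R)"
proof -
  interpret cring R by fact
  interpret S: cring "gauss_ring R" by (rule cring_gauss_ring) fact
  show ?thesis
    by (rule ring_hom_ringI[OF ring_axioms S.ring_axioms])
      (auto simp: gauss_embed_def gauss_ring_simps minus_eq)
qed

lemma flat_gauss_ring:
  fixes R :: "(nat, 'm) ring_scheme" (structure)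
  assumes "cring R" "flat_abelian_group (add_monoid R)"
  shows "flat_abelian_group (add_monoid (gauss_ring R))"
proof -
  interpret cring R by fact
  interpret S: cring "gauss_ring R" by (rule cring_gauss_ring) fact
  show ?thesis
  proof (rule flat_abelian_group_biproduct[OF a_comm_group S.a_comm_group _ _ _ _ _ assms(2)])
    show "gauss_re \<in> hom (add_monoid (gauss_ring R)) (add_monoid R)"
      "gauss_im \<in> hom (add_monoid (gauss_ring R)) (add_monoid R)"
      by (auto simp: hom_def gauss_ring_def)
    show "(\<lambda>x. gauss x \<zero>) \<in> hom (add_monoid R) (add_monoid (gauss_ring R))"
      "(\<lambda>y. gauss \<zero> y) \<in> hom (add_monoid R) (add_monoid (gauss_ring R))"
      by (auto simp: hom_def gauss_ring_def)
  qed (auto simp: gauss_ring_def)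
qed

lemma (in cring) gauss_norm_mult:
  assumes "x \<in> carrier R" "y \<in> carrier R" "x' \<in> carrier R" "y' \<in> carrier R"
  shows "(x \<otimes> x' \<ominus> y \<otimes> y') \<otimes> (x \<otimes> x' \<ominus> y \<otimes> y') \<oplus> (x \<otimes> y' \<oplus> y \<otimes> x') \<otimes> (x \<otimes> y' \<oplus> y \<otimes> x')
    = (x \<otimes> x \<oplus> y \<otimes> y) \<otimes> (x' \<otimes> x' \<oplus> y' \<otimes> y')"
proof -
  have l: "in_carrier [x, y, x', y']"
    using assms by (simp add: in_carrier_def)
  let ?x = "Var 0" and ?y = "Var 1" and ?x' = "Var 2" and ?y' = "Var 3"
  let ?re = "Sub (Mul ?x ?x') (Mul ?y ?y')" and ?im = "Add (Mul ?x ?y') (Mul ?y ?x')"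
  have "norm (Add (Mul ?re ?re) (Mul ?im ?im))
    = norm (Mul (Add (Mul ?x ?x) (Mul ?y ?y)) (Add (Mul ?x' ?x') (Mul ?y' ?y')))"
    by code_simp
  from norm_eq[OF l this] show ?thesis by simp
qed

text \<open>
  If \<open>a\<^sup>2 + b\<^sup>2 = 0\<close>, then \<open>x + \<i> y \<mapsto> b x + a y\<close> is \<open>b\<close> times the evaluation of \<open>\<i>\<close> at \<open>a / b\<close>.  This
  is the multiplicativity of that evaluation, with denominators cleared.
\<close>

lemma (in cring) gauss_specialize_mult:
  assumes "a \<in> carrier R" "b \<in> carrier R"
    "x \<in> carrier R" "y \<in> carrier R" "x' \<in> carrier R" "y' \<in> carrier R"
  shows "b \<otimes> (b \<otimes> (x \<otimes> x' \<ominus> y \<otimes> y') \<oplus> a \<otimes> (x \<otimes> y' \<oplus> y \<otimes> x')) \<oplus> y \<otimes> y' \<otimes> (a \<otimes> a \<oplus> b \<otimes> b)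
    = (b \<otimes> x \<oplus> a \<otimes> y) \<otimes> (b \<otimes> x' \<oplus> a \<otimes> y')"
proof -
  have l: "in_carrier [a, b, x, y, x', y']"
    using assms by (simp add: in_carrier_def)
  let ?a = "Var 0" and ?b = "Var 1"
  let ?x = "Var 2" and ?y = "Var 3" and ?x' = "Var 4" and ?y' = "Var 5"
  have "norm (Add (Mul ?b (Add (Mul ?b (Sub (Mul ?x ?x') (Mul ?y ?y')))
           (Mul ?a (Add (Mul ?x ?y') (Mul ?y ?x'))))) (Mul (Mul ?y ?y') (Add (Mul ?a ?a) (Mul ?b ?b))))
    = norm (Mul (Add (Mul ?b ?x) (Mul ?a ?y)) (Add (Mul ?b ?x') (Mul ?a ?y')))"
    by code_simp
  from norm_eq[OF l this] show ?thesis by simp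
qed

lemma (in ideal) add_mem_iff:
  assumes "x \<in> carrier R" "y \<in> I"
  shows "x \<oplus> y \<in> I \<longleftrightarrow> x \<in> I"
proof
  assume "x \<oplus> y \<in> I"
  then have "(x \<oplus> y) \<oplus> (\<ominus> y) \<in> I"
    using assms by (simp add: a_closed a_inv_closed)
  also have "(x \<oplus> y) \<oplus> (\<ominus> y) = x"
    using assms Icarr by (simp add: a_assoc r_neg)
  finally show "x \<in> I" .
qed (use assms in \<open>simp add: a_closed\<close>)

lemma (in primeideal) prime_iff:
  assumes "x \<in> carrier R" "y \<in> carrier R"
  shows "x \<otimes> y \<in> I \<longleftrightarrow> x \<in> I \<or> y \<in> I"
  using I_prime[OF assms] I_l_closed[OF _ assms(1), of y] I_r_closed[OF _ assms(2), of x] by blast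

text \<open>
  Lying over for \<open>R[\<i>]\<close>.  If \<open>-1\<close> is not a square in the fraction field of \<open>R / Q\<close>, then \<open>Q R[\<i>]\<close> is
  prime, as the norm \<open>x\<^sup>2 + y\<^sup>2\<close> shows.  Otherwise \<open>-1 = (a / b)\<^sup>2\<close> there, and the prime is the kernel
  of the evaluation of \<open>\<i>\<close> at \<open>a / b\<close>.
\<close>

lemma gauss_ring_lying_over:
  fixes R :: "(nat, 'm) ring_scheme" (structure)
  assumes R: "cring R" and Q: "primeideal Q R"
  shows "\<exists>J. primeideal J (gauss_ring R) \<and> (\<forall>x\<in>carrier R. gauss_embed R x \<in> J \<longleftrightarrow> x \<in> Q)"
proof -
  interpret cring R by fact
  interpret S: cring "gauss_ring R" by (rule cring_gauss_ring) fact
  interpret Q: primeideal Q R by fact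
  have inv: "\<ominus>\<^bsub>gauss_ring R\<^esub> gauss x y = gauss (\<ominus> x) (\<ominus> y)"
    if "x \<in> carrier R" "y \<in> carrier R" for x y
    by (rule S.minus_equality) (use that in \<open>auto simp: gauss_ring_simps l_neg\<close>)
  note Q_closed = Q.a_closed Q.a_inv_closed Q.I_l_closed Q.I_r_closed
  show ?thesis
  proof (cases "\<exists>a\<in>carrier R. \<exists>b\<in>carrier R. a \<otimes> a \<oplus> b \<otimes> b \<in> Q \<and> b \<notin> Q")
    case False
    then have sq: "b \<in> Q" if "a \<otimes> a \<oplus> b \<otimes> b \<in> Q" "a \<in> carrier R" "b \<in> carrier R" for a b
      using that by blast
    define J where "J = {gauss x y | x y. x \<in> Q \<and> y \<in> Q}"
    have J: "gauss x y \<in> J \<longleftrightarrow> x \<in> Q \<and> y \<in> Q" for x y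
      by (auto simp: J_def)
    have JE: "\<exists>x y. z = gauss x y \<and> x \<in> Q \<and> y \<in> Q" if "z \<in> J" for z
      using that by (auto simp: J_def)
    have "primeideal J (gauss_ring R)"
    proof (rule primeidealI2)
      show "additive_subgroup J (gauss_ring R)"
      proof (rule additive_subgroupI, rule S.add.subgroupI)
        show "J \<subseteq> carrier (gauss_ring R)"
          using Q.Icarr by (auto simp: J_def gauss_ring_simps)
        show "J \<noteq> {}"
          using Q.zero_closed J[of \<zero> \<zero>] by auto
        fix z assume "z \<in> J"
        then show "\<ominus>\<^bsub>gauss_ring R\<^esub> z \<in> J"
          using Q.Icarr by (auto dest!: JE simp: inv J Q_closed)
        fix w assume "w \<in> J"
        with \<open>z \<in> J\<close> show "z \<oplus>\<^bsub>gauss_ring R\<^esub> w \<in> J"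
          by (auto dest!: JE simp: gauss_ring_simps J Q_closed)
      qed
      show "cring (gauss_ring R)" ..
      fix z w assume z: "z \<in> J" and w: "w \<in> carrier (gauss_ring R)"
      then show "w \<otimes>\<^bsub>gauss_ring R\<^esub> z \<in> J" "z \<otimes>\<^bsub>gauss_ring R\<^esub> w \<in> J"
        by (auto dest!: JE elim!: carrier_gauss_ringE simp: gauss_ring_simps J minus_eq Q_closed)
    next
      show "carrier (gauss_ring R) \<noteq> J"
        using S.one_closed Q.one_imp_carrier Q.I_notcarr
        by (metis J gauss_ring_simps(3))
    next
      fix z w
      assume "z \<in> carrier (gauss_ring R)" "w \<in> carrier (gauss_ring R)"
        and zw: "z \<otimes>\<^bsub>gauss_ring R\<^esub> w \<in> J"
      then obtain x y x' y' where [simp]: "z = gauss x y" "w = gauss x' y'"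
        and c: "x \<in> carrier R" "y \<in> carrier R" "x' \<in> carrier R" "y' \<in> carrier R"
        by (auto simp: carrier_gauss_ring)
      have "x \<otimes> x' \<ominus> y \<otimes> y' \<in> Q" "x \<otimes> y' \<oplus> y \<otimes> x' \<in> Q"
        using zw by (auto simp: gauss_ring_simps J)
      then have "(x \<otimes> x \<oplus> y \<otimes> y) \<otimes> (x' \<otimes> x' \<oplus> y' \<otimes> y') \<in> Q"
        unfolding gauss_norm_mult[OF c, symmetric] using c by (simp add: Q_closed)
      then have "x \<otimes> x \<oplus> y \<otimes> y \<in> Q \<or> x' \<otimes> x' \<oplus> y' \<otimes> y' \<in> Q"
        using c by (simp add: Q.prime_iff)
      then show "z \<in> J \<or> w \<in> J"
        using sq[of x y] sq[of y x] sq[of x' y'] sq[of y' x'] c by (auto simp: J a_comm)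
    qed
    then show ?thesis
      by (auto simp: gauss_embed_def J)
  next
    case True
    then obtain a b where a: "a \<in> carrier R" and b: "b \<in> carrier R" "b \<notin> Q"
      and ab: "a \<otimes> a \<oplus> b \<otimes> b \<in> Q"
      by blast
    define J where "J = {gauss x y | x y. x \<in> carrier R \<and> y \<in> carrier R \<and> b \<otimes> x \<oplus> a \<otimes> y \<in> Q}"
    have J: "gauss x y \<in> J \<longleftrightarrow> b \<otimes> x \<oplus> a \<otimes> y \<in> Q" if "x \<in> carrier R" "y \<in> carrier R" for x y
      using that by (auto simp: J_def)
    have JE: "\<exists>x y. z = gauss x y \<and> x \<in> carrier R \<and> y \<in> carrier R \<and> b \<otimes> x \<oplus> a \<otimes> y \<in> Q"
      if "z \<in> J" for z
      using that by (auto simp: J_def)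
    have mult: "gauss x y \<otimes>\<^bsub>gauss_ring R\<^esub> gauss x' y' \<in> J \<longleftrightarrow> gauss x y \<in> J \<or> gauss x' y' \<in> J"
      if c: "x \<in> carrier R" "y \<in> carrier R" "x' \<in> carrier R" "y' \<in> carrier R" for x y x' y'
    proof -
      let ?v = "b \<otimes> (x \<otimes> x' \<ominus> y \<otimes> y') \<oplus> a \<otimes> (x \<otimes> y' \<oplus> y \<otimes> x')"
      have "?v \<in> Q \<longleftrightarrow> b \<otimes> ?v \<in> Q"
        using a b c by (subst Q.prime_iff) auto
      also have "\<dots> \<longleftrightarrow> b \<otimes> ?v \<oplus> y \<otimes> y' \<otimes> (a \<otimes> a \<oplus> b \<otimes> b) \<in> Q"
        using a b c ab by (subst Q.add_mem_iff) (auto intro: Q_closed)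
      also have "\<dots> \<longleftrightarrow> (b \<otimes> x \<oplus> a \<otimes> y) \<otimes> (b \<otimes> x' \<oplus> a \<otimes> y') \<in> Q"
        by (subst gauss_specialize_mult[OF a b(1) c]) (rule refl)
      also have "\<dots> \<longleftrightarrow> b \<otimes> x \<oplus> a \<otimes> y \<in> Q \<or> b \<otimes> x' \<oplus> a \<otimes> y' \<in> Q"
        using a b c by (subst Q.prime_iff) auto
      finally show ?thesis
        using c by (simp add: gauss_ring_simps J)
    qed
    have "primeideal J (gauss_ring R)"
    proof (rule primeidealI2)
      show "additive_subgroup J (gauss_ring R)"
      proof (rule additive_subgroupI, rule S.add.subgroupI)
        show "J \<subseteq> carrier (gauss_ring R)"
          by (auto simp: J_def gauss_ring_simps)
        show "J \<noteq> {}"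
          using Q.zero_closed a b J[of \<zero> \<zero>] by auto
        fix z assume "z \<in> J"
        then obtain x y where z: "z = gauss x y" "x \<in> carrier R" "y \<in> carrier R" "b \<otimes> x \<oplus> a \<otimes> y \<in> Q"
          by (blast dest: JE)
        have "b \<otimes> (\<ominus> x) \<oplus> a \<otimes> (\<ominus> y) = \<ominus> (b \<otimes> x \<oplus> a \<otimes> y)"
          using z a b by (simp add: r_minus minus_add)
        then show "\<ominus>\<^bsub>gauss_ring R\<^esub> z \<in> J"
          using z Q.a_inv_closed[OF z(4)] by (simp add: inv J)
        fix w assume "w \<in> J"
        then obtain x' y' where w: "w = gauss x' y'" "x' \<in> carrier R" "y' \<in> carrier R"
            "b \<otimes> x' \<oplus> a \<otimes> y' \<in> Q"
          by (blast dest: JE)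
        have "b \<otimes> (x \<oplus> x') \<oplus> a \<otimes> (y \<oplus> y') = (b \<otimes> x \<oplus> a \<otimes> y) \<oplus> (b \<otimes> x' \<oplus> a \<otimes> y')"
          using z w a b by (simp add: r_distr a_ac)
        then show "z \<oplus>\<^bsub>gauss_ring R\<^esub> w \<in> J"
          using z w Q.a_closed[OF z(4) w(4)] by (simp add: gauss_ring_simps J)
      qed
      show "cring (gauss_ring R)" ..
      fix z w assume z: "z \<in> J" and w: "w \<in> carrier (gauss_ring R)"
      then obtain x y where z': "z = gauss x y" "x \<in> carrier R" "y \<in> carrier R"
        by (blast dest: JE)
      from w obtain x' y' where "w = gauss x' y'" "x' \<in> carrier R" "y' \<in> carrier R"
        by (rule carrier_gauss_ringE)
      with z' show "w \<otimes>\<^bsub>gauss_ring R\<^esub> z \<in> J" "z \<otimes>\<^bsub>gauss_ring R\<^esub> w \<in> J"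
        using z by (auto simp: mult)
    next
      have "gauss \<one> \<zero> \<notin> J"
        using a b by (subst J) auto
      then show "carrier (gauss_ring R) \<noteq> J"
        using S.one_closed by (auto simp: gauss_ring_simps)
    next
      fix z w
      assume "z \<in> carrier (gauss_ring R)" "w \<in> carrier (gauss_ring R)"
        and zw: "z \<otimes>\<^bsub>gauss_ring R\<^esub> w \<in> J"
      then obtain x y x' y' where [simp]: "z = gauss x y" "w = gauss x' y'"
        and c: "x \<in> carrier R" "y \<in> carrier R" "x' \<in> carrier R" "y' \<in> carrier R"
        by (auto simp: carrier_gauss_ring)
      show "z \<in> J \<or> w \<in> J"
        using zw mult[OF c] by simp
    qed
    moreover have "gauss_embed R x \<in> J \<longleftrightarrow> x \<in> Q" if "x \<in> carrier R" for x
      using that a b by (simp add: gauss_embed_def J Q.prime_iff)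
    ultimately show ?thesis
      by blast
  qed
qed

lemma spec_surjective_gauss_ring:
  fixes R :: "(nat, 'm) ring_scheme" (structure)
  assumes R: "cring R" and surj: "spec_surjective R"
  shows "spec_surjective (gauss_ring R)"
  unfolding spec_surjective_def
proof (intro allI impI)
  fix P assume "primeideal P \<Z>"
  then obtain Q where Q: "primeideal Q R" "of_int_ring R -` Q = P"
    using surj by (auto simp: spec_surjective_def)
  obtain J where J: "primeideal J (gauss_ring R)"
      "\<And>x. x \<in> carrier R \<Longrightarrow> gauss_embed R x \<in> J \<longleftrightarrow> x \<in> Q"
    using gauss_ring_lying_over[OF R Q(1)] by blast
  interpret cring R by fact
  interpret I: ring_hom_ring \<Z> R "of_int_ring R" by (rule of_int_ring_hom_ring)
  interpret E: ring_hom_ring R "gauss_ring R" "gauss_embed R" by (rule gauss_embed_hom) fact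
  have "of_int_ring (gauss_ring R) k \<in> J \<longleftrightarrow> of_int_ring R k \<in> Q" for k
    using J(2)[of "of_int_ring R k"] I.hom_closed[of k] by (simp add: E.of_int_ring_hom)
  then show "\<exists>Q. primeideal Q (gauss_ring R) \<and> of_int_ring (gauss_ring R) -` Q = P"
    using J(1) Q(2) by blast
qed

section \<open>Finite presentation of the extension\<close>

text \<open>
  The real and imaginary parts of \<open>\<i>\<^sup>k\<close>.
\<close>

primrec imag_unit_power :: "nat \<Rightarrow> int \<times> int" where
  "imag_unit_power 0 = (1, 0)"
| "imag_unit_power (Suc k) = (- snd (imag_unit_power k), fst (imag_unit_power k))"

lemma imag_unit_power_add:
  "fst (imag_unit_power (k + l)) = fst (imag_unit_power k) * fst (imag_unit_power l)
     - snd (imag_unit_power k) * snd (imag_unit_power l)"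
  "snd (imag_unit_power (k + l)) = fst (imag_unit_power k) * snd (imag_unit_power l)
     + snd (imag_unit_power k) * fst (imag_unit_power l)"
  by (induction k) (auto simp: algebra_simps)

text \<open>
  The monomial \<open>u\<close> without its factor in the variable \<open>X\<^sub>n\<close>.
\<close>

definition drop_var :: "nat \<Rightarrow> (nat \<Rightarrow>\<^sub>0 nat) \<Rightarrow> (nat \<Rightarrow>\<^sub>0 nat)" where
  "drop_var n u = Poly_Mapping.update n 0 u"

lemma lookup_drop_var:
  "Poly_Mapping.lookup (drop_var n u) i = (if i = n then 0 else Poly_Mapping.lookup u i)"
  by (simp add: drop_var_def lookup_update)

lemma drop_var_add: "drop_var n (u + v) = drop_var n u + drop_var n v"
  by (rule poly_mapping_eqI) (simp add: lookup_drop_var lookup_add)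

lemma drop_var_split: "u = drop_var n u + Poly_Mapping.single n (Poly_Mapping.lookup u n)"
  by (rule poly_mapping_eqI) (auto simp: lookup_drop_var lookup_add lookup_single when_def)

lemma keys_drop_var: "Poly_Mapping.keys (drop_var n u) = Poly_Mapping.keys u - {n}"
  by (auto simp: in_keys_iff lookup_drop_var split: if_splits)

lemma drop_var_ident:
  assumes "Poly_Mapping.keys u \<subseteq> {..<n}"
  shows "drop_var n u = u" "Poly_Mapping.lookup u n = 0"
proof -
  show 0: "Poly_Mapping.lookup u n = 0"
    using assms by (metis in_keys_iff lessThan_iff less_irrefl subsetD)
  show "drop_var n u = u"
    by (rule poly_mapping_eqI) (simp add: lookup_drop_var 0)
qed

text \<open>
  The real and imaginary parts of the polynomial obtained by putting \<open>X\<^sub>n = \<i>\<close>, as the additive maps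
  that are given on monomials by the powers of \<open>\<i>\<close>.
\<close>

definition subst_i_re :: "nat \<Rightarrow> ((nat \<Rightarrow>\<^sub>0 nat) \<Rightarrow>\<^sub>0 int) \<Rightarrow> ((nat \<Rightarrow>\<^sub>0 nat) \<Rightarrow>\<^sub>0 int)" where
  "subst_i_re n = frag_extend (\<lambda>u. Poly_Mapping.single (drop_var n u)
     (fst (imag_unit_power (Poly_Mapping.lookup u n))))"

definition subst_i_im :: "nat \<Rightarrow> ((nat \<Rightarrow>\<^sub>0 nat) \<Rightarrow>\<^sub>0 int) \<Rightarrow> ((nat \<Rightarrow>\<^sub>0 nat) \<Rightarrow>\<^sub>0 int)" where
  "subst_i_im n = frag_extend (\<lambda>u. Poly_Mapping.single (drop_var n u)
     (snd (imag_unit_power (Poly_Mapping.lookup u n))))"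

lemma subst_i_simps:
  "subst_i_re n 0 = 0" "subst_i_im n 0 = 0"
  "subst_i_re n (p + q) = subst_i_re n p + subst_i_re n q"
  "subst_i_im n (p + q) = subst_i_im n p + subst_i_im n q"
  "subst_i_re n (p - q) = subst_i_re n p - subst_i_re n q"
  "subst_i_im n (p - q) = subst_i_im n p - subst_i_im n q"
  by (simp_all add: subst_i_re_def subst_i_im_def frag_extend_add frag_extend_diff)

lemma subst_i_of:
  "subst_i_re n (frag_of u) = Poly_Mapping.single (drop_var n u)
     (fst (imag_unit_power (Poly_Mapping.lookup u n)))"
  "subst_i_im n (frag_of u) = Poly_Mapping.single (drop_var n u)
     (snd (imag_unit_power (Poly_Mapping.lookup u n)))"
  by (simp_all add: subst_i_re_def subst_i_im_def)

lemma subst_i_mult: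
  "subst_i_re n (p * q) = subst_i_re n p * subst_i_re n q - subst_i_im n p * subst_i_im n q \<and>
   subst_i_im n (p * q) = subst_i_re n p * subst_i_im n q + subst_i_im n p * subst_i_re n q"
  (is "?P p q")
  using subset_UNIV[of "Poly_Mapping.keys p"]
proof (induction p rule: frag_induction)
  case zero
  show ?case by (simp add: subst_i_simps)
next
  case (one u)
  show ?case
    using subset_UNIV[of "Poly_Mapping.keys q"]
  proof (induction q rule: frag_induction)
    case zero
    show ?case by (simp add: subst_i_simps)
  next
    case (one v)
    show ?case
      by (simp add: mult_single subst_i_of drop_var_add lookup_add imag_unit_power_add
          single_diff single_add)
  next
    case (diff a b)
    note IH = diff(1)[THEN conjunct1] diff(1)[THEN conjunct2]
      diff(2)[THEN conjunct1] diff(2)[THEN conjunct2]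
    show ?case
      unfolding right_diff_distrib subst_i_simps IH by (simp add: algebra_simps)
  qed
next
  case (diff a b)
  note IH = diff(1)[THEN conjunct1] diff(1)[THEN conjunct2]
    diff(2)[THEN conjunct1] diff(2)[THEN conjunct2]
  show ?case
    unfolding left_diff_distrib subst_i_simps IH by (simp add: algebra_simps)
qed

lemmas subst_i_re_mult = subst_i_mult[THEN conjunct1]
lemmas subst_i_im_mult = subst_i_mult[THEN conjunct2]

lemma subst_i_ident:
  assumes "\<forall>u \<in> Poly_Mapping.keys p. Poly_Mapping.keys u \<subseteq> {..<n}"
  shows "subst_i_re n p = p \<and> subst_i_im n p = 0"
proof -
  have "Poly_Mapping.keys p \<subseteq> {u. Poly_Mapping.keys u \<subseteq> {..<n}}"
    using assms by auto
  then show ?thesis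
    by (induction p rule: frag_induction) (auto simp: subst_i_simps subst_i_of drop_var_ident)
qed

lemma carrier_int_mpoly:
  "p \<in> carrier (int_mpoly n) \<longleftrightarrow> (\<forall>u \<in> Poly_Mapping.keys p. Poly_Mapping.keys u \<subseteq> {..<n})"
  by (simp add: int_mpoly_def)

lemma int_mpoly_simps [simp]:
  "p \<otimes>\<^bsub>int_mpoly n\<^esub> q = p * q" "p \<oplus>\<^bsub>int_mpoly n\<^esub> q = p + q"
  "\<one>\<^bsub>int_mpoly n\<^esub> = 1" "\<zero>\<^bsub>int_mpoly n\<^esub> = 0"
  by (simp_all add: int_mpoly_def)

lemma int_mpoly_closed:
  "0 \<in> carrier (int_mpoly n)" "1 \<in> carrier (int_mpoly n)"
  "p \<in> carrier (int_mpoly n) \<Longrightarrow> - p \<in> carrier (int_mpoly n)"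
  "p \<in> carrier (int_mpoly n) \<Longrightarrow> q \<in> carrier (int_mpoly n) \<Longrightarrow> p + q \<in> carrier (int_mpoly n)"
  "p \<in> carrier (int_mpoly n) \<Longrightarrow> q \<in> carrier (int_mpoly n) \<Longrightarrow> p - q \<in> carrier (int_mpoly n)"
  "p \<in> carrier (int_mpoly n) \<Longrightarrow> q \<in> carrier (int_mpoly n) \<Longrightarrow> p * q \<in> carrier (int_mpoly n)"
proof -
  show "0 \<in> carrier (int_mpoly n)" "1 \<in> carrier (int_mpoly n)"
    by (simp_all add: carrier_int_mpoly flip: single_one)
  show "- p \<in> carrier (int_mpoly n)" if "p \<in> carrier (int_mpoly n)"
    using that by (simp add: carrier_int_mpoly)
  assume pq: "p \<in> carrier (int_mpoly n)" "q \<in> carrier (int_mpoly n)"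
  then show "p + q \<in> carrier (int_mpoly n)"
    using keys_add[of p q] unfolding carrier_int_mpoly by blast
  show "p - q \<in> carrier (int_mpoly n)"
    using pq keys_diff[of p q] unfolding carrier_int_mpoly by blast
  show "p * q \<in> carrier (int_mpoly n)"
    unfolding carrier_int_mpoly
  proof
    fix u assume "u \<in> Poly_Mapping.keys (p * q)"
    then obtain v w where u: "u = v + w" and v: "v \<in> Poly_Mapping.keys p" and w: "w \<in> Poly_Mapping.keys q"
      using keys_mult[of p q] by blast
    have "Poly_Mapping.keys v \<union> Poly_Mapping.keys w \<subseteq> {..<n}"
      using pq v w by (auto simp: carrier_int_mpoly)
    then show "Poly_Mapping.keys u \<subseteq> {..<n}"
      using keys_add[of v w] u by blast
  qed
qed

lemma cring_int_mpoly: "cring (int_mpoly n)"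
proof (rule cringI)
  show "abelian_group (int_mpoly n)"
  proof (rule abelian_groupI)
    fix p assume "p \<in> carrier (int_mpoly n)"
    then show "\<exists>q\<in>carrier (int_mpoly n). q \<oplus>\<^bsub>int_mpoly n\<^esub> p = \<zero>\<^bsub>int_mpoly n\<^esub>"
      by (intro bexI[of _ "- p"]) (simp_all add: int_mpoly_closed)
  qed (simp_all add: int_mpoly_closed add_ac)
  show "comm_monoid (int_mpoly n)"
    by (rule comm_monoidI) (simp_all add: int_mpoly_closed mult_ac)
qed (simp add: distrib_right)

lemma int_mpoly_mono: "n \<le> k \<Longrightarrow> carrier (int_mpoly n) \<subseteq> carrier (int_mpoly k)"
  by (force simp: carrier_int_mpoly)

lemma subst_i_closed:
  assumes "p \<in> carrier (int_mpoly (Suc n))"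
  shows "subst_i_re n p \<in> carrier (int_mpoly n)" "subst_i_im n p \<in> carrier (int_mpoly n)"
proof -
  have *: "frag_extend (\<lambda>u. Poly_Mapping.single (drop_var n u) (c u)) p \<in> carrier (int_mpoly n)"
    for c :: "(nat \<Rightarrow>\<^sub>0 nat) \<Rightarrow> int"
    unfolding carrier_int_mpoly
  proof
    fix v assume "v \<in> Poly_Mapping.keys (frag_extend (\<lambda>u. Poly_Mapping.single (drop_var n u) (c u)) p)"
    then obtain u where u: "u \<in> Poly_Mapping.keys p"
        and v: "v \<in> Poly_Mapping.keys (Poly_Mapping.single (drop_var n u) (c u))"
      using subsetD[OF keys_frag_extend] by fast
    have "v = drop_var n u"
      using v by (simp split: if_splits)
    then show "Poly_Mapping.keys v \<subseteq> {..<n}"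
      using u assms by (force simp: keys_drop_var carrier_int_mpoly less_Suc_eq)
  qed
  show "subst_i_re n p \<in> carrier (int_mpoly n)" "subst_i_im n p \<in> carrier (int_mpoly n)"
    unfolding subst_i_re_def subst_i_im_def by (rule *)+
qed

text \<open>
  The variable \<open>X\<^sub>n\<close>.
\<close>

definition mpoly_var :: "nat \<Rightarrow> (nat \<Rightarrow>\<^sub>0 nat) \<Rightarrow>\<^sub>0 int" where
  "mpoly_var n = frag_of (Poly_Mapping.single n 1)"

lemma mpoly_var_closed: "n < k \<Longrightarrow> mpoly_var n \<in> carrier (int_mpoly k)"
  by (simp add: mpoly_var_def carrier_int_mpoly)

lemma mpoly_var_power: "mpoly_var n ^ k = frag_of (Poly_Mapping.single n k)"
  by (induction k) (simp_all add: mpoly_var_def mult_single flip: single_add)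

lemma subst_i_var: "subst_i_re n (mpoly_var n) = 0" "subst_i_im n (mpoly_var n) = 1"
proof -
  have "drop_var n (Poly_Mapping.single n 1) = 0"
    by (rule poly_mapping_eqI) (simp add: lookup_drop_var lookup_single when_def)
  then show "subst_i_re n (mpoly_var n) = 0" "subst_i_im n (mpoly_var n) = 1"
    by (simp_all add: mpoly_var_def subst_i_of)
qed

lemma subst_i_1: "subst_i_re n 1 = 1" "subst_i_im n 1 = 0"
  using subst_i_ident[of 1 n] by (simp_all flip: single_one)

lemma int_mpoly_minus:
  assumes "p \<in> carrier (int_mpoly n)"
  shows "\<ominus>\<^bsub>int_mpoly n\<^esub> p = - p"
proof -
  interpret cring "int_mpoly n" by (rule cring_int_mpoly)
  show ?thesis
    by (rule minus_equality) (use assms in \<open>simp_all add: int_mpoly_closed\<close>)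
qed

text \<open>
  Modulo \<open>X\<^sub>n\<^sup>2 + 1\<close> every polynomial is congruent to its value at \<open>X\<^sub>n = \<i>\<close>, with \<open>\<i>\<close> written as \<open>X\<^sub>n\<close>.
\<close>

lemma subst_i_congruence:
  assumes J: "ideal J (int_mpoly (Suc n))" and rel: "mpoly_var n * mpoly_var n + 1 \<in> J"
    and p: "p \<in> carrier (int_mpoly (Suc n))"
  shows "p - subst_i_re n p - mpoly_var n * subst_i_im n p \<in> J"
proof -
  interpret P: cring "int_mpoly (Suc n)" by (rule cring_int_mpoly)
  interpret J: ideal J "int_mpoly (Suc n)" by fact
  let ?X = "mpoly_var n"
  have X: "?X \<in> carrier (int_mpoly (Suc n))"
    by (simp add: mpoly_var_closed)
  have add: "a + b \<in> J" if "a \<in> J" "b \<in> J" for a b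
    using J.a_closed[OF that] by simp
  have diff: "a - b \<in> J" if "a \<in> J" "b \<in> J" for a b
    using add[OF that(1) J.a_inv_closed[OF that(2)]] J.Icarr[OF that(2)] by (simp add: int_mpoly_minus)
  have mult: "b * a \<in> J" if "a \<in> J" "b \<in> carrier (int_mpoly (Suc n))" for a b
    using J.I_l_closed[OF that] by simp
  have const: "Poly_Mapping.single 0 c \<in> carrier (int_mpoly k)" for c :: int and k
    by (simp add: carrier_int_mpoly)
  have power: "?X ^ k - Poly_Mapping.single 0 (fst (imag_unit_power k))
      - ?X * Poly_Mapping.single 0 (snd (imag_unit_power k)) \<in> J" for k
  proof (induction k)
    case 0
    show ?case using J.zero_closed by simp
  next
    case (Suc k)
    let ?c = "Poly_Mapping.single 0 (fst (imag_unit_power k)) :: (nat \<Rightarrow>\<^sub>0 nat) \<Rightarrow>\<^sub>0 int"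
    let ?s = "Poly_Mapping.single 0 (snd (imag_unit_power k)) :: (nat \<Rightarrow>\<^sub>0 nat) \<Rightarrow>\<^sub>0 int"
    have "?X * (?X ^ k - ?c - ?X * ?s) + ?s * (?X * ?X + 1) \<in> J"
      by (intro add mult Suc rel X const)
    then show ?case
      by (simp add: algebra_simps single_uminus)
  qed
  have "Poly_Mapping.keys p \<subseteq> {u. Poly_Mapping.keys u \<subseteq> {..<Suc n}}"
    using p by (auto simp: carrier_int_mpoly)
  then show ?thesis
  proof (induction p rule: frag_induction)
    case zero
    show ?case using J.zero_closed by (simp add: subst_i_simps)
  next
    case (one u)
    let ?k = "Poly_Mapping.lookup u n" and ?u = "frag_of (drop_var n u)"
    let ?c = "Poly_Mapping.single 0 (fst (imag_unit_power ?k))"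
    let ?s = "Poly_Mapping.single 0 (snd (imag_unit_power ?k))"
    have u: "frag_of u = ?u * ?X ^ ?k"
      by (simp add: mpoly_var_power mult_single flip: drop_var_split)
    have re: "subst_i_re n (frag_of u) = ?u * ?c" and im: "subst_i_im n (frag_of u) = ?u * ?s"
      by (simp_all add: subst_i_of mult_single)
    have "?u \<in> carrier (int_mpoly (Suc n))"
      using one by (auto simp: carrier_int_mpoly keys_drop_var)
    then have "?u * (?X ^ ?k - ?c - ?X * ?s) \<in> J"
      by (rule mult[OF power])
    also have "?u * (?X ^ ?k - ?c - ?X * ?s)
        = frag_of u - subst_i_re n (frag_of u) - ?X * subst_i_im n (frag_of u)"
      unfolding u[symmetric] re im right_diff_distrib by (simp only: mult.left_commute)
    finally show ?case .
  next
    case (diff a b)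
    from \<open>\<And>b a. a \<in> J \<Longrightarrow> b \<in> J \<Longrightarrow> a - b \<in> J\<close>[OF diff] show ?case
      by (simp add: subst_i_simps algebra_simps)
  qed
qed

lemma a_kernel_iff: "x \<in> a_kernel R S h \<longleftrightarrow> x \<in> carrier R \<and> h x = \<zero>\<^bsub>S\<^esub>"
  by (simp add: a_kernel_def')

text \<open>
  A presentation \<open>h\<close> of \<open>R\<close> in the variables \<open>X\<^sub>0, \<dots>, X\<^bsub>n-1\<^esub>\<close> extends to \<open>R[\<i>]\<close> by \<open>X\<^sub>n \<mapsto> \<i>\<close>.  The
  kernel is generated by the old relations and \<open>X\<^sub>n\<^sup>2 + 1\<close>.
\<close>

lemma finitely_presented_gauss_ring:
  fixes R :: "(nat, 'm) ring_scheme" (structure)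
  assumes R: "cring R" and fp: "finitely_presented_ring R"
  shows "finitely_presented_ring (gauss_ring R)"
proof -
  interpret cring R by fact
  interpret S: cring "gauss_ring R" by (rule cring_gauss_ring) fact
  obtain n h F where h: "h \<in> ring_hom (int_mpoly n) R" and surj: "h ` carrier (int_mpoly n) = carrier R"
    and F: "finite F" "F \<subseteq> carrier (int_mpoly n)"
    and ker: "a_kernel (int_mpoly n) R h = Idl\<^bsub>int_mpoly n\<^esub> F"
    using fp unfolding finitely_presented_ring_def by blast
  interpret P: cring "int_mpoly n" by (rule cring_int_mpoly)
  interpret P': cring "int_mpoly (Suc n)" by (rule cring_int_mpoly)
  interpret h: ring_hom_ring "int_mpoly n" R h
    by (rule ring_hom_ringI2[OF P.ring_axioms ring_axioms h])
  have h_closed: "h p \<in> carrier R" if "p \<in> carrier (int_mpoly n)" for p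
    using that by (rule h.hom_closed)
  have h_add: "h (p + q) = h p \<oplus> h q"
    if "p \<in> carrier (int_mpoly n)" "q \<in> carrier (int_mpoly n)" for p q
    using h.hom_add[OF that] by simp
  have h_mult: "h (p * q) = h p \<otimes> h q"
    if "p \<in> carrier (int_mpoly n)" "q \<in> carrier (int_mpoly n)" for p q
    using h.hom_mult[OF that] by simp
  have h_diff: "h (p - q) = h p \<ominus> h q"
    if "p \<in> carrier (int_mpoly n)" "q \<in> carrier (int_mpoly n)" for p q
    using h.hom_minus[OF that] by (simp add: P.minus_eq int_mpoly_minus that)
  have h_1: "h 1 = \<one>" and h_0: "h 0 = \<zero>"
    using h.hom_one h.hom_zero by simp_all
  define g where "g p = gauss (h (subst_i_re n p)) (h (subst_i_im n p))" for p
  let ?X = "mpoly_var n"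
  have X: "?X \<in> carrier (int_mpoly (Suc n))"
    by (simp add: mpoly_var_closed)
  have le: "p \<in> carrier (int_mpoly (Suc n))" if "p \<in> carrier (int_mpoly n)" for p
    using that int_mpoly_mono[of n "Suc n"] by auto
  have ident: "subst_i_re n p = p" "subst_i_im n p = 0" if "p \<in> carrier (int_mpoly n)" for p
    using that subst_i_ident[of p n] by (simp_all add: carrier_int_mpoly)
  have g: "g \<in> ring_hom (int_mpoly (Suc n)) (gauss_ring R)"
    by (rule ring_hom_memI)
      (simp_all add: g_def gauss_ring_simps subst_i_simps subst_i_re_mult subst_i_im_mult subst_i_1
        h_add h_mult h_diff h_1 h_0 h_closed subst_i_closed int_mpoly_closed)
  interpret g: ring_hom_ring "int_mpoly (Suc n)" "gauss_ring R" g
    by (rule ring_hom_ringI2[OF P'.ring_axioms S.ring_axioms g])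
  have g_surj: "g ` carrier (int_mpoly (Suc n)) = carrier (gauss_ring R)"
  proof (intro equalityI subsetI)
    fix z assume "z \<in> carrier (gauss_ring R)"
    then obtain p q where p: "p \<in> carrier (int_mpoly n)" and q: "q \<in> carrier (int_mpoly n)"
      and z: "z = gauss (h p) (h q)"
      by (auto simp: carrier_gauss_ring simp flip: surj)
    have "z = g (p + ?X * q)"
      by (simp add: g_def z subst_i_simps subst_i_re_mult subst_i_im_mult subst_i_var ident p q)
    then show "z \<in> g ` carrier (int_mpoly (Suc n))"
      using int_mpoly_closed(4)[OF le[OF p] int_mpoly_closed(6)[OF X le[OF q]]] by blast
  qed auto
  define F' where "F' = insert (?X * ?X + 1) F"
  have F': "finite F'" "F' \<subseteq> carrier (int_mpoly (Suc n))"
    using F le X by (auto simp: F'_def intro!: int_mpoly_closed)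
  define J where "J = Idl\<^bsub>int_mpoly (Suc n)\<^esub> F'"
  have ideal_J: "ideal J (int_mpoly (Suc n))"
    unfolding J_def by (rule P'.genideal_ideal) fact
  interpret J: ideal J "int_mpoly (Suc n)" by (rule ideal_J)
  have F'_J: "F' \<subseteq> J"
    unfolding J_def by (rule P'.genideal_self) fact
  have rel: "?X * ?X + 1 \<in> J"
    using F'_J by (simp add: F'_def)
  have J_add: "a + b \<in> J" if "a \<in> J" "b \<in> J" for a b
    using J.a_closed[OF that] by simp
  have J_mult: "b * a \<in> J" if "a \<in> J" "b \<in> carrier (int_mpoly (Suc n))" for a b
    using J.I_l_closed[OF that] by simp
  have J_mult': "a * b \<in> J" if "a \<in> J" "b \<in> carrier (int_mpoly (Suc n))" for a b
    using J.I_r_closed[OF that] by simp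
  have J_minus: "- a \<in> J" if "a \<in> J" for a
    using J.a_inv_closed[OF that] J.Icarr[OF that] by (simp add: int_mpoly_minus)
  have "ideal (J \<inter> carrier (int_mpoly n)) (int_mpoly n)"
  proof (rule idealI[OF P.ring_axioms])
    show "subgroup (J \<inter> carrier (int_mpoly n)) (add_monoid (int_mpoly n))"
    proof (rule P.add.subgroupI)
      show "J \<inter> carrier (int_mpoly n) \<noteq> {}"
        using J.zero_closed int_mpoly_closed(1)[of n] by auto
    qed (auto simp: int_mpoly_minus J_minus J_add int_mpoly_closed)
  qed (auto intro: J_mult J_mult' int_mpoly_closed le)
  then have Idl_J: "Idl\<^bsub>int_mpoly n\<^esub> F \<subseteq> J"
    using P.genideal_minimal[of "J \<inter> carrier (int_mpoly n)" F] F F'_J by (auto simp: F'_def)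
  have "a_kernel (int_mpoly (Suc n)) (gauss_ring R) g = J"
  proof
    show "a_kernel (int_mpoly (Suc n)) (gauss_ring R) g \<subseteq> J"
    proof
      fix p assume "p \<in> a_kernel (int_mpoly (Suc n)) (gauss_ring R) g"
      then have p: "p \<in> carrier (int_mpoly (Suc n))" and "g p = \<zero>\<^bsub>gauss_ring R\<^esub>"
        unfolding a_kernel_iff by blast+
      then have "h (subst_i_re n p) = \<zero>" "h (subst_i_im n p) = \<zero>"
        by (simp_all add: g_def gauss_ring_simps)
      then have "subst_i_re n p \<in> J" "subst_i_im n p \<in> J"
        using Idl_J subst_i_closed[OF p] unfolding ker[symmetric] by (blast intro: a_kernel_iff[THEN iffD2])+
      then have "(p - subst_i_re n p - ?X * subst_i_im n p) + subst_i_re n p + ?X * subst_i_im n p \<in> J"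
        by (intro J_add J_mult subst_i_congruence[OF ideal_J rel p] X)
      then show "p \<in> J" by simp
    qed
    have F_ker: "F \<subseteq> a_kernel (int_mpoly n) R h"
      unfolding ker using F(2) by (rule P.genideal_self)
    have "g p = \<zero>\<^bsub>gauss_ring R\<^esub>" if "p \<in> F" for p
    proof -
      have "h p = \<zero>" and "p \<in> carrier (int_mpoly n)"
        using F_ker that F(2) unfolding subset_iff a_kernel_iff by blast+
      then show ?thesis
        unfolding g_def by (simp only: ident h_0 gauss_ring_simps)
    qed
    moreover have "g (?X * ?X + 1) = \<zero>\<^bsub>gauss_ring R\<^esub>"
      by (simp add: g_def subst_i_simps subst_i_re_mult subst_i_im_mult subst_i_var subst_i_1 h_0
          gauss_ring_simps)
    ultimately have "F' \<subseteq> a_kernel (int_mpoly (Suc n)) (gauss_ring R) g"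
      using F'(2) unfolding F'_def by (auto simp only: a_kernel_iff insert_iff subset_iff)
    then show "J \<subseteq> a_kernel (int_mpoly (Suc n)) (gauss_ring R) g"
      unfolding J_def by (rule P'.genideal_minimal[OF g.kernel_is_ideal])
  qed
  then show ?thesis
    unfolding finitely_presented_ring_def J_def using g g_surj F' by blast
qed

lemma fppf_cover_gauss_ring:
  fixes R :: "nat ring"
  assumes "fppf_cover R"
  shows "fppf_cover (gauss_ring R)"
  using assms unfolding fppf_cover_def
  by (blast intro: cring_gauss_ring flat_gauss_ring finitely_presented_gauss_ring
      spec_surjective_gauss_ring)

section \<open>Integral classes of forms\<close>

text \<open>
  Since \<open>isometries R f g\<close> consists of the \<open>A\<close> with \<open>g \<circ> A = f\<close>, isometries compose like maps from
  \<open>f\<close> to \<open>g\<close>.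
\<close>

lemma (in cring) isometries_trans:
  assumes A: "A \<in> isometries R f g" and B: "B \<in> isometries R e f"
  shows "mat2_mult R A B \<in> isometries R e g"
proof -
  interpret I: ring_hom_ring \<Z> R "of_int_ring R" by (rule of_int_ring_hom_ring)
  have g: "bqf_base_change R g \<in> carrier R \<times> carrier R \<times> carrier R"
    using I.hom_closed by (auto simp: bqf_base_change_def split: prod.splits)
  show ?thesis
    using A B g unfolding isometries_def GL2_def
    by (simp add: mat2_mult_closed det2_mult bqf_subst_mult[symmetric])
qed

lemma (in ring_hom_ring) map_mat2_isometries:
  assumes R: "cring R" and A: "A \<in> isometries R f g"
  shows "map_mat2 h A \<in> isometries S f g"
proof -
  interpret I: ring_hom_ring \<Z> R "of_int_ring R" by (rule R.of_int_ring_hom_ring)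
  have g: "bqf_base_change R g \<in> carrier R \<times> carrier R \<times> carrier R"
    using I.hom_closed by (auto simp: bqf_base_change_def split: prod.splits)
  show ?thesis
    using A bqf_subst_map[OF g, of A] map_mat2_GL2[of A]
    unfolding isometries_def bqf_base_change_map by (simp add: GL2_def)
qed

lemma Units_int: "x \<in> Units \<Z> \<longleftrightarrow> x = 1 \<or> x = - 1"
  by (auto simp: Units_def zmult_eq_1_iff)

lemma of_int_ring_int: "of_int_ring \<Z> k = k"
proof -
  interpret I: ring_hom_ring \<Z> \<Z> "of_int_ring \<Z>"
    by (rule ring.of_int_ring_hom_ring) (rule cring.axioms(1)[OF int_is_cring])
  have one: "of_int_ring \<Z> 1 = 1" using I.hom_one by simp
  have add: "of_int_ring \<Z> (k + l) = of_int_ring \<Z> k + of_int_ring \<Z> l" for k l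
    using I.hom_add[of k l] by simp
  show ?thesis
  proof (induction k rule: int_induct[where k = 0])
    case base
    show ?case using I.hom_zero by simp
  next
    case (step1 i)
    then show ?case using add[of i 1] one by simp
  next
    case (step2 i)
    then show ?case using add[of "i - 1" 1] one by simp
  qed
qed

lemma bqf_base_change_int: "bqf_base_change \<Z> f = f"
  by (cases f) (simp add: bqf_base_change_def of_int_ring_int)

lemma int_isometries_iff:
  "A \<in> isometries \<Z> f g \<longleftrightarrow> A \<in> GL2 \<Z> \<and> bqf_subst \<Z> g A = f"
  by (simp add: isometries_def bqf_base_change_int)

lemma proper_class_iff: "g \<in> proper_class f \<longleftrightarrow> proper_isometries \<Z> g f \<noteq> {}"
  unfolding proper_class_def proper_isometries_def SL2_def by (auto simp: int_isometries_iff)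

lemma full_class_iff: "g \<in> full_class f \<longleftrightarrow> isometries \<Z> g f \<noteq> {}"
  unfolding full_class_def by (auto simp: int_isometries_iff)

lemma (in cring) proper_isometries_trans:
  assumes A: "A \<in> proper_isometries R f g" and B: "B \<in> proper_isometries R e f"
  shows "mat2_mult R A B \<in> proper_isometries R e g"
  using isometries_trans[of A f g B e] A B
  by (auto simp: proper_isometries_def SL2_def isometries_def GL2_def det2_mult)

lemma (in ring_hom_ring) map_mat2_proper_isometries:
  assumes R: "cring R" and A: "A \<in> proper_isometries R f g"
  shows "map_mat2 h A \<in> proper_isometries S f g"
  using map_mat2_isometries[OF R, of A f g] A
  by (auto simp: proper_isometries_def SL2_def isometries_def GL2_def det2_map_mat2)

lemma det2_int: "det2 \<Z> (p, q, r, s) = p * s - q * r"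
  by (simp add: det2_def int_a_minus_eq)

lemma GL2_int: "A \<in> GL2 \<Z> \<longleftrightarrow> det2 \<Z> A = 1 \<or> det2 \<Z> A = - 1"
  by (cases A) (simp add: GL2_def Units_int)

lemma int_isometries_sym:
  assumes "A \<in> isometries \<Z> f g"
  obtains B where "B \<in> isometries \<Z> g f" "det2 \<Z> B = det2 \<Z> A"
proof -
  obtain p q r s where A: "A = (p, q, r, s)" by (metis prod_cases4)
  define e where "e = p * s - q * r"
  have e: "e * e = 1" and f: "bqf_subst \<Z> g A = f"
    using assms by (auto simp: int_isometries_iff GL2_int A det2_int e_def)
  define B where "B = (e * s, - e * q, - e * r, e * p)"
  have det: "det2 \<Z> B = det2 \<Z> A"
  proof -
    have "det2 \<Z> B = (e * e) * (p * s - q * r)"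
      by (simp add: B_def det2_int algebra_simps)
    then show ?thesis
      by (simp add: e A det2_int)
  qed
  have "mat2_mult \<Z> A B = (e * e, 0, 0, e * e)"
    by (simp add: mat2_mult_def A B_def e_def algebra_simps)
  then have "bqf_subst \<Z> f B = bqf_subst \<Z> g (1, 0, 0, 1)"
    using cring.bqf_subst_mult[OF int_is_cring, of g A B] f e by (simp add: mem_Times_iff)
  also have "\<dots> = g"
    by (cases g) (simp add: bqf_subst_def)
  finally have "B \<in> isometries \<Z> g f"
    using assms det by (simp add: int_isometries_iff GL2_int)
  then show ?thesis using that det by blast
qed

lemma id_proper_isometry: "(1, 0, 0, 1) \<in> proper_isometries \<Z> f f"
  by (cases f) (simp add: proper_isometries_def SL2_def int_isometries_iff GL2_int det2_int bqf_subst_def)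

lemma proper_class_refl: "f \<in> proper_class f"
  using id_proper_isometry proper_class_iff by blast

lemma proper_class_sym: "g \<in> proper_class f \<Longrightarrow> f \<in> proper_class g"
proof -
  assume "g \<in> proper_class f"
  then obtain A where A: "A \<in> isometries \<Z> g f" "det2 \<Z> A = 1"
    by (auto simp: proper_class_iff proper_isometries_def SL2_def)
  obtain B where "B \<in> isometries \<Z> f g" "det2 \<Z> B = 1"
    using int_isometries_sym[OF A(1)] A(2) by metis
  then show ?thesis
    by (auto simp: proper_class_iff proper_isometries_def SL2_def isometries_def)
qed

lemma proper_class_trans: "g \<in> proper_class f \<Longrightarrow> h \<in> proper_class g \<Longrightarrow> h \<in> proper_class f"
  unfolding proper_class_iff using cring.proper_isometries_trans[OF int_is_cring] by blast

lemma proper_class_eq: "g \<in> proper_class f \<Longrightarrow> proper_class g = proper_class f"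
  using proper_class_sym proper_class_trans by blast

lemma full_class_refl: "f \<in> full_class f"
  using id_proper_isometry unfolding full_class_iff proper_isometries_def by blast

lemma full_class_trans: "g \<in> full_class f \<Longrightarrow> h \<in> full_class g \<Longrightarrow> h \<in> full_class f"
  unfolding full_class_iff using cring.isometries_trans[OF int_is_cring] by blast

text \<open>
  The action of \<open>-1 \<in> \<mu>\<^sub>2(\<int>)\<close> on forms, which is substitution of \<open>diag(1, -1)\<close>.
\<close>

definition bqf_flip :: "int bqf \<Rightarrow> int bqf" where
  "bqf_flip = (\<lambda>(a, b, c). (a, - b, c))"

lemma bqf_flip_flip [simp]: "bqf_flip (bqf_flip f) = f"
  by (cases f) (simp add: bqf_flip_def)

text \<open>
  The matrix \<open>diag(1, -1)\<close>.
\<close>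

abbreviation reflection :: "int mat2" where
  "reflection \<equiv> (1, 0, 0, - 1)"

lemma reflection_isometry: "reflection \<in> isometries \<Z> (bqf_flip f) f"
  by (cases f) (simp add: int_isometries_iff GL2_int det2_int bqf_subst_def bqf_flip_def)

lemma proper_class_flip:
  assumes "g \<in> proper_class f"
  shows "bqf_flip g \<in> proper_class (bqf_flip f)"
proof -
  note isometries_trans = cring.isometries_trans[OF int_is_cring]
  obtain A where A: "A \<in> isometries \<Z> g f" "det2 \<Z> A = 1"
    using assms by (auto simp: proper_class_iff proper_isometries_def SL2_def)
  let ?B = "mat2_mult \<Z> (mat2_mult \<Z> reflection A) reflection"
  have "reflection \<in> isometries \<Z> f (bqf_flip f)"
    using reflection_isometry[of "bqf_flip f"] by simp
  then have "?B \<in> isometries \<Z> (bqf_flip g) (bqf_flip f)"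
    by (intro isometries_trans[OF isometries_trans[OF _ A(1)] reflection_isometry])
  moreover have "det2 \<Z> ?B = 1"
    using A(2) by (cases A) (simp add: mat2_mult_def det2_int)
  ultimately show ?thesis
    by (auto simp: proper_class_iff proper_isometries_def SL2_def isometries_def)
qed

lemma flip_image_proper_class: "bqf_flip ` proper_class f = proper_class (bqf_flip f)"
  using proper_class_flip[of _ f] proper_class_flip[of _ "bqf_flip f"]
  by (auto simp: image_iff) (metis bqf_flip_flip)

text \<open>
  A matrix of determinant \<open>-1\<close> is \<open>diag(1, -1)\<close> times a matrix of determinant 1.
\<close>

lemma full_class_eq: "full_class f = proper_class f \<union> proper_class (bqf_flip f)"
proof (intro equalityI subsetI)
  note isometries_trans = cring.isometries_trans[OF int_is_cring]
  fix g assume "g \<in> full_class f"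
  then obtain A where A: "A \<in> isometries \<Z> g f"
    by (auto simp: full_class_iff)
  show "g \<in> proper_class f \<union> proper_class (bqf_flip f)"
  proof (cases "det2 \<Z> A = 1")
    case True
    then show ?thesis
      using A by (auto simp: proper_class_iff proper_isometries_def SL2_def isometries_def)
  next
    case False
    then have "det2 \<Z> A = - 1"
      using A by (auto simp: int_isometries_iff GL2_int)
    then have "det2 \<Z> (mat2_mult \<Z> reflection A) = 1"
      by (cases A) (simp add: mat2_mult_def det2_int)
    moreover have "mat2_mult \<Z> reflection A \<in> isometries \<Z> g (bqf_flip f)"
      using isometries_trans[OF _ A] reflection_isometry[of "bqf_flip f"] by simp
    ultimately show ?thesis
      by (auto simp: proper_class_iff proper_isometries_def SL2_def isometries_def)
  qed
next
  fix g assume "g \<in> proper_class f \<union> proper_class (bqf_flip f)"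
  moreover have "proper_class h \<subseteq> full_class h" for h
    by (auto simp: proper_class_iff full_class_iff proper_isometries_def)
  moreover have "bqf_flip f \<in> full_class f"
    using reflection_isometry full_class_iff by blast
  ultimately show "g \<in> full_class f"
    using full_class_trans by blast
qed

lemma proper_classes_of_full_class:
  "proper_class ` full_class f = {proper_class f, proper_class (bqf_flip f)}"
proof -
  have "proper_class ` proper_class h = {proper_class h}" for h
  proof -
    have "proper_class ` proper_class h = (\<lambda>_. proper_class h) ` proper_class h"
      by (rule image_cong) (simp_all add: proper_class_eq)
    also have "\<dots> = {proper_class h}"
      by (rule image_constant[OF proper_class_refl])
    finally show ?thesis .
  qed
  then show ?thesis
    by (simp add: full_class_eq image_Un insert_commute)
qed

lemma bqf_disc_int: "bqf_disc \<Z> (a, b, c) = b\<^sup>2 - 4 * a * c"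
  by (simp add: bqf_disc_def int_a_minus_eq power2_eq_square)

lemma full_class_disc:
  assumes "g \<in> full_class f"
  shows "bqf_disc \<Z> g = bqf_disc \<Z> f"
proof -
  obtain A where "A \<in> GL2 \<Z>" "bqf_subst \<Z> f A = g"
    using assms unfolding full_class_def by blast
  then show ?thesis
    using cring.bqf_disc_subst[OF int_is_cring, of f A] by (auto simp: GL2_int mem_Times_iff)
qed

section \<open>Local isometries with diagonal forms\<close>

lemma (in cring) of_int_ring_closed [simp]: "of_int_ring R k \<in> carrier R"
  by (simp add: of_int_ring_def)

lemma (in cring) isometries_disc:
  assumes "A \<in> isometries R f g"
  shows "of_int_ring R (bqf_disc \<Z> f) = det2 R A \<otimes> det2 R A \<otimes> of_int_ring R (bqf_disc \<Z> g)"
proof -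
  interpret I: ring_hom_ring \<Z> R "of_int_ring R" by (rule of_int_ring_hom_ring)
  have disc: "bqf_disc R (bqf_base_change R h) = of_int_ring R (bqf_disc \<Z> h)" for h
    using I.bqf_disc_map[of h] by (simp add: bqf_base_change_eq mem_Times_iff)
  have "bqf_base_change R g \<in> carrier R \<times> carrier R \<times> carrier R"
    by (auto simp: bqf_base_change_def split: prod.splits)
  then show ?thesis
    using bqf_disc_subst[of "bqf_base_change R g" A] assms
    by (simp add: isometries_def GL2_def disc)
qed

text \<open>
  If \<open>k - l\<close> is zero in \<open>R\<close>, then it is associated to the integer 0.
\<close>

lemma fppf_cover_of_int_inj:
  assumes R: "fppf_cover R" and eq: "of_int_ring R k = of_int_ring R l"
  shows "k = l"
proof -
  interpret cring R using R by (simp add: fppf_cover_def)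
  interpret I: ring_hom_ring \<Z> R "of_int_ring R" by (rule of_int_ring_hom_ring)
  have "of_int_ring R (k - l) = of_int_ring R k \<ominus>\<^bsub>R\<^esub> of_int_ring R l"
    using I.hom_minus[of k l] by (simp add: int_a_minus_eq)
  then have "of_int_ring R (k - l) = \<one>\<^bsub>R\<^esub> \<otimes>\<^bsub>R\<^esub> of_int_ring R 0"
    using eq I.hom_zero by simp
  then show ?thesis
    using fppf_cover_associated[OF R Units_one_closed, of "k - l" 0] by auto
qed

lemma fppf_properly_isometric_disc:
  assumes "fppf_properly_isometric f g"
  shows "bqf_disc \<Z> f = bqf_disc \<Z> g"
proof -
  obtain R :: "nat ring" and A where R: "fppf_cover R" and A: "A \<in> proper_isometries R f g"
    using assms by (auto simp: fppf_properly_isometric_def)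
  interpret cring R using R by (simp add: fppf_cover_def)
  show ?thesis
    using isometries_disc[of A f g] A
    by (intro fppf_cover_of_int_inj[OF R]) (simp add: proper_isometries_def SL2_def)
qed

lemma fppf_properly_isometric_proper_class:
  assumes "fppf_properly_isometric f g" "h \<in> proper_class g"
  shows "fppf_properly_isometric f h"
proof -
  obtain R :: "nat ring" and A where R: "fppf_cover R" and A: "A \<in> proper_isometries R f g"
    using assms by (auto simp: fppf_properly_isometric_def)
  obtain B where B: "B \<in> proper_isometries \<Z> g h"
    using proper_class_sym[OF assms(2)] by (auto simp: proper_class_iff)
  interpret cring R using R by (simp add: fppf_cover_def)
  interpret I: ring_hom_ring \<Z> R "of_int_ring R" by (rule of_int_ring_hom_ring)
  have "mat2_mult R (map_mat2 (of_int_ring R) B) A \<in> proper_isometries R f h"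
    by (rule proper_isometries_trans[OF I.map_mat2_proper_isometries[OF int_is_cring B] A])
  then show ?thesis
    using R by (auto simp: fppf_properly_isometric_def)
qed

lemma proper_class_in_H1_Oplus_iff:
  "proper_class g \<in> H1_Oplus f \<longleftrightarrow> fppf_properly_isometric f g"
  unfolding H1_Oplus_def
  using fppf_properly_isometric_proper_class proper_class_refl by blast

text \<open>
  A diagonal form is fixed by \<open>diag(1, -1)\<close>, so a proper isometry from it may be conjugated.
\<close>

lemma fppf_properly_isometric_flip:
  assumes "fppf_properly_isometric (a, 0, c) g"
  shows "fppf_properly_isometric (a, 0, c) (bqf_flip g)"
proof -
  obtain R :: "nat ring" and A where R: "fppf_cover R" and A: "A \<in> proper_isometries R (a, 0, c) g"
    using assms by (auto simp: fppf_properly_isometric_def)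
  interpret cring R using R by (simp add: fppf_cover_def)
  interpret I: ring_hom_ring \<Z> R "of_int_ring R" by (rule of_int_ring_hom_ring)
  let ?D = "map_mat2 (of_int_ring R) reflection"
  have 1: "?D \<in> isometries R g (bqf_flip g)"
    using I.map_mat2_isometries[OF int_is_cring reflection_isometry[of "bqf_flip g"]] by simp
  have 2: "?D \<in> isometries R (a, 0, c) (a, 0, c)"
    using I.map_mat2_isometries[OF int_is_cring reflection_isometry[of "(a, 0, c)"]]
    by (simp add: bqf_flip_def)
  have A': "A \<in> isometries R (a, 0, c) g" "det2 R A = \<one>\<^bsub>R\<^esub>"
    using A by (auto simp: proper_isometries_def SL2_def)
  let ?B = "mat2_mult R (mat2_mult R ?D A) ?D"
  have B: "?B \<in> isometries R (a, 0, c) (bqf_flip g)"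
    by (rule isometries_trans[OF isometries_trans[OF 1 A'(1)] 2])
  have "det2 R ?D = of_int_ring R (- 1)"
    using I.det2_map_mat2[of reflection] by (simp add: det2_int)
  then have "det2 R ?B = of_int_ring R (- 1) \<otimes>\<^bsub>R\<^esub> of_int_ring R (- 1)"
    using 1 A' by (simp add: isometries_def GL2_def det2_mult mat2_mult_closed)
  also have "\<dots> = \<one>\<^bsub>R\<^esub>"
    using I.hom_mult[of "- 1" "- 1"] I.hom_one by simp
  finally have "?B \<in> proper_isometries R (a, 0, c) (bqf_flip g)"
    using B by (auto simp: proper_isometries_def SL2_def isometries_def)
  then show ?thesis
    using R by (auto simp: fppf_properly_isometric_def)
qed

lemma (in cring) diagonal_isometry:
  assumes u: "u \<in> Units R" and uu: "u \<otimes> u = of_int_ring R e"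
  shows "(\<one>, \<zero>, \<zero>, u) \<in> isometries R (a, 0, c * e) (a, 0, c)"
    and "det2 R (\<one>, \<zero>, \<zero>, u) = u"
proof -
  interpret I: ring_hom_ring \<Z> R "of_int_ring R" by (rule of_int_ring_hom_ring)
  have uc: "u \<in> carrier R" using u by blast
  show det: "det2 R (\<one>, \<zero>, \<zero>, u) = u"
    using uc by (simp add: det2_def minus_eq)
  have "of_int_ring R (c * e) = of_int_ring R c \<otimes> u \<otimes> u"
    using I.hom_mult[of c e] uc by (simp add: uu m_assoc)
  moreover have "of_int_ring R 0 = \<zero>"
    using I.hom_zero by simp
  ultimately show "(\<one>, \<zero>, \<zero>, u) \<in> isometries R (a, 0, c * e) (a, 0, c)"
    using uc u det by (simp add: isometries_def GL2_def bqf_base_change_def bqf_subst_def)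
qed

text \<open>
  The heart of the matter: locally isometric to \<open>(1, 0, -c)\<close> means locally properly isometric to
  \<open>(1, 0, -c)\<close> or to \<open>(1, 0, c)\<close>.
\<close>

lemma fppf_isometric_diagonal_iff:
  assumes c: "c \<noteq> 0"
  shows "fppf_isometric (1, 0, - c) f \<longleftrightarrow>
    fppf_properly_isometric (1, 0, - c) f \<or> fppf_properly_isometric (1, 0, c) f"
proof (intro iffI; (elim disjE)?)
  assume "fppf_isometric (1, 0, - c) f"
  then obtain R :: "nat ring" and A where R: "fppf_cover R" and A: "A \<in> isometries R (1, 0, - c) f"
    by (auto simp: fppf_isometric_def)
  interpret cring R using R by (simp add: fppf_cover_def)
  interpret I: ring_hom_ring \<Z> R "of_int_ring R" by (rule of_int_ring_hom_ring)
  define \<delta> where "\<delta> = det2 R A"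
  have \<delta>: "\<delta> \<in> Units R" and A4: "A \<in> carrier R \<times> carrier R \<times> carrier R \<times> carrier R"
    using A by (auto simp: isometries_def GL2_def \<delta>_def)
  then have \<delta>c: "\<delta> \<in> carrier R" "inv\<^bsub>R\<^esub> \<delta> \<in> carrier R" by auto
  have disc: "of_int_ring R (4 * c) = \<delta> \<otimes>\<^bsub>R\<^esub> \<delta> \<otimes>\<^bsub>R\<^esub> of_int_ring R (bqf_disc \<Z> f)"
    using isometries_disc[OF A] by (simp add: bqf_disc_int \<delta>_def)
  have "4 * c = bqf_disc \<Z> f \<or> 4 * c = - bqf_disc \<Z> f"
    using c \<delta> by (intro fppf_cover_associated[OF R _ _ disc]) auto
  then have "bqf_disc \<Z> f = 1 * (4 * c) \<or> bqf_disc \<Z> f = - 1 * (4 * c)"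
    by auto
  then obtain e :: int where e: "e = 1 \<or> e = - 1" and disc_f: "bqf_disc \<Z> f = e * (4 * c)"
    by blast
  have ee: "of_int_ring R e \<otimes>\<^bsub>R\<^esub> of_int_ring R e = \<one>\<^bsub>R\<^esub>"
  proof -
    have "e * e = 1"
      using e by auto
    then show ?thesis
      using I.hom_mult[of e e] I.hom_one by simp
  qed
  have "of_int_ring R (4 * c) \<otimes>\<^bsub>R\<^esub> (\<one>\<^bsub>R\<^esub> \<ominus>\<^bsub>R\<^esub> \<delta> \<otimes>\<^bsub>R\<^esub> \<delta> \<otimes>\<^bsub>R\<^esub> of_int_ring R e)
      = of_int_ring R (4 * c)
        \<ominus>\<^bsub>R\<^esub> \<delta> \<otimes>\<^bsub>R\<^esub> \<delta> \<otimes>\<^bsub>R\<^esub> (of_int_ring R e \<otimes>\<^bsub>R\<^esub> of_int_ring R (4 * c))"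
    using \<delta>c by (simp add: minus_eq r_distr r_minus m_ac)
  also have "of_int_ring R e \<otimes>\<^bsub>R\<^esub> of_int_ring R (4 * c) = of_int_ring R (bqf_disc \<Z> f)"
    using I.hom_mult[of e "4 * c"] disc_f by simp
  also have "of_int_ring R (4 * c) \<ominus>\<^bsub>R\<^esub> \<delta> \<otimes>\<^bsub>R\<^esub> \<delta> \<otimes>\<^bsub>R\<^esub> of_int_ring R (bqf_disc \<Z> f) = \<zero>\<^bsub>R\<^esub>"
    using \<delta>c by (simp add: disc[symmetric])
  finally have "\<one>\<^bsub>R\<^esub> \<ominus>\<^bsub>R\<^esub> \<delta> \<otimes>\<^bsub>R\<^esub> \<delta> \<otimes>\<^bsub>R\<^esub> of_int_ring R e = \<zero>\<^bsub>R\<^esub>"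
    by (rule fppf_cover_torsion_free[OF R, rotated 2]) (use \<delta>c c in simp_all)
  then have one: "\<delta> \<otimes>\<^bsub>R\<^esub> \<delta> \<otimes>\<^bsub>R\<^esub> of_int_ring R e = \<one>\<^bsub>R\<^esub>"
    using \<delta>c by simp
  \<comment> \<open>The inverse, so that the corrected isometry has determinant 1 also when \<open>\<delta>\<^sup>2 = -1\<close>.\<close>
  define u where "u = inv\<^bsub>R\<^esub> \<delta>"
  have u: "u \<in> Units R" "u \<in> carrier R" and \<delta>u: "\<delta> \<otimes>\<^bsub>R\<^esub> u = \<one>\<^bsub>R\<^esub>"
    using \<delta> by (auto simp: u_def)
  have "u \<otimes>\<^bsub>R\<^esub> u = (\<delta> \<otimes>\<^bsub>R\<^esub> \<delta> \<otimes>\<^bsub>R\<^esub> of_int_ring R e) \<otimes>\<^bsub>R\<^esub> (u \<otimes>\<^bsub>R\<^esub> u)"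
    using u by (simp add: one)
  also have "\<dots> = (\<delta> \<otimes>\<^bsub>R\<^esub> u) \<otimes>\<^bsub>R\<^esub> (\<delta> \<otimes>\<^bsub>R\<^esub> u) \<otimes>\<^bsub>R\<^esub> of_int_ring R e"
    using u \<delta>c by (simp add: m_ac)
  finally have uu: "u \<otimes>\<^bsub>R\<^esub> u = of_int_ring R e"
    using \<delta>u by simp
  let ?D = "(\<one>\<^bsub>R\<^esub>, \<zero>\<^bsub>R\<^esub>, \<zero>\<^bsub>R\<^esub>, u)"
  have "mat2_mult R A ?D \<in> isometries R (1, 0, (- c) * e) f"
    by (rule isometries_trans[OF A diagonal_isometry(1)[OF u(1) uu]])
  moreover have "det2 R (mat2_mult R A ?D) = \<one>\<^bsub>R\<^esub>"
    using A4 u(2) \<delta>u by (subst det2_mult) (auto simp: diagonal_isometry(2)[OF u(1) uu] \<delta>_def)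
  ultimately have "mat2_mult R A ?D \<in> proper_isometries R (1, 0, (- c) * e) f"
    by (auto simp: proper_isometries_def SL2_def isometries_def)
  then have "fppf_properly_isometric (1, 0, (- c) * e) f"
    using R by (auto simp: fppf_properly_isometric_def)
  then show "fppf_properly_isometric (1, 0, - c) f \<or> fppf_properly_isometric (1, 0, c) f"
    using e by auto
next
  assume "fppf_properly_isometric (1, 0, - c) f"
  then show "fppf_isometric (1, 0, - c) f"
    by (auto simp: fppf_properly_isometric_def fppf_isometric_def proper_isometries_def)
next
  assume "fppf_properly_isometric (1, 0, c) f"
  then obtain R :: "nat ring" and A where R: "fppf_cover R" and A: "A \<in> isometries R (1, 0, c) f"
    by (auto simp: fppf_properly_isometric_def proper_isometries_def)
  interpret cring R using R by (simp add: fppf_cover_def)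
  interpret S: cring "gauss_ring R" by (rule cring_gauss_ring) (rule is_cring)
  interpret E: ring_hom_ring R "gauss_ring R" "gauss_embed R" by (rule gauss_embed_hom) (rule is_cring)
  interpret I: ring_hom_ring \<Z> R "of_int_ring R" by (rule of_int_ring_hom_ring)
  \<comment> \<open>The square root of \<open>-1\<close> and its inverse.\<close>
  let ?i = "gauss \<zero>\<^bsub>R\<^esub> \<one>\<^bsub>R\<^esub>" and ?j = "gauss \<zero>\<^bsub>R\<^esub> (\<ominus>\<^bsub>R\<^esub> \<one>\<^bsub>R\<^esub>)"
  have ij: "?i \<otimes>\<^bsub>gauss_ring R\<^esub> ?j = \<one>\<^bsub>gauss_ring R\<^esub>" and i: "?i \<in> carrier (gauss_ring R)"
    and j: "?j \<in> carrier (gauss_ring R)"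
    by (simp_all add: gauss_ring_simps minus_eq)
  have "?j \<otimes>\<^bsub>gauss_ring R\<^esub> ?i = \<one>\<^bsub>gauss_ring R\<^esub>"
    using ij S.m_comm[OF i j] by (simp only:)
  with ij i j have iU: "?i \<in> Units (gauss_ring R)"
    unfolding Units_def by blast
  have "of_int_ring R (- 1) = \<ominus>\<^bsub>R\<^esub> \<one>\<^bsub>R\<^esub>"
    using I.hom_a_inv[of 1] I.hom_one by (simp add: int_a_inv_eq)
  then have "?i \<otimes>\<^bsub>gauss_ring R\<^esub> ?i = gauss_embed R (of_int_ring R (- 1))"
    by (simp add: gauss_ring_simps gauss_embed_def minus_eq)
  then have ii: "?i \<otimes>\<^bsub>gauss_ring R\<^esub> ?i = of_int_ring (gauss_ring R) (- 1)"
    unfolding E.of_int_ring_hom .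
  have "mat2_mult (gauss_ring R) (map_mat2 (gauss_embed R) A)
      (\<one>\<^bsub>gauss_ring R\<^esub>, \<zero>\<^bsub>gauss_ring R\<^esub>, \<zero>\<^bsub>gauss_ring R\<^esub>, ?i) \<in> isometries (gauss_ring R) (1, 0, c * - 1) f"
    by (rule S.isometries_trans[OF E.map_mat2_isometries[OF is_cring A] S.diagonal_isometry(1)[OF iU ii]])
  then show "fppf_isometric (1, 0, - c) f"
    using fppf_cover_gauss_ring[OF R] by (auto simp: fppf_isometric_def)
qed

section \<open>The action on proper classes and the decomposition\<close>

lemma carrier_mu2_Z: "e \<in> carrier mu2_Z \<longleftrightarrow> e = 1 \<or> e = - 1"
  by (simp add: mu2_Z_def power2_eq_1_iff)

lemma mu2_action_proper_class:
  assumes "proper_class g \<in> H1_Oplus f"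
  shows "mu2_action f 1 (proper_class g) = proper_class g"
    and "mu2_action f (- 1) (proper_class g) = proper_class (bqf_flip g)"
proof -
  have "(\<lambda>(a, b, c). (a, 1 * b, c)) = (id :: int bqf \<Rightarrow> _)" 
    "(\<lambda>(a, b, c). (a, - 1 * b, c)) = bqf_flip"
    by (auto simp: bqf_flip_def)
  then show "mu2_action f 1 (proper_class g) = proper_class g"
    and "mu2_action f (- 1) (proper_class g) = proper_class (bqf_flip g)"
    using assms unfolding mu2_action_def by (simp_all add: flip_image_proper_class)
qed

lemma H1_OplusE:
  assumes "X \<in> H1_Oplus f"
  obtains g where "X = proper_class g" "fppf_properly_isometric f g"
  using assms unfolding H1_Oplus_def by blast

lemma mu2_group_action:
  fixes a c :: int
  defines "f \<equiv> (a, 0, c)"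
  shows "group_action mu2_Z (H1_Oplus f) (mu2_action f)"
proof -
  have closed: "mu2_action f e X \<in> H1_Oplus f" if "e \<in> carrier mu2_Z" "X \<in> H1_Oplus f" for e X
    using that unfolding f_def
    by (auto simp: carrier_mu2_Z mu2_action_proper_class proper_class_in_H1_Oplus_iff
        fppf_properly_isometric_flip elim!: H1_OplusE)
  have mult: "mu2_action f (e * e') X = mu2_action f e (mu2_action f e' X)"
    if "e \<in> carrier mu2_Z" "e' \<in> carrier mu2_Z" "X \<in> H1_Oplus f" for e e' X
    using that unfolding f_def
    by (auto simp: carrier_mu2_Z mu2_action_proper_class proper_class_in_H1_Oplus_iff
        fppf_properly_isometric_flip elim!: H1_OplusE)
  have square: "e * e = 1" if "e \<in> carrier mu2_Z" for e
    using that by (auto simp: carrier_mu2_Z)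
  have one: "mu2_action f 1 X = X" if "X \<in> H1_Oplus f" for X
    using that by (auto simp: mu2_action_proper_class proper_class_in_H1_Oplus_iff elim!: H1_OplusE)
  have bij: "mu2_action f e \<in> Bij (H1_Oplus f)" if e: "e \<in> carrier mu2_Z" for e
  proof -
    have "bij_betw (mu2_action f e) (H1_Oplus f) (H1_Oplus f)"
      by (rule bij_betw_byWitness[where f' = "mu2_action f e"])
        (use e in \<open>auto simp: closed one square simp flip: mult\<close>)
    then show ?thesis
      by (auto simp: Bij_def mu2_action_def)
  qed
  have grp: "group mu2_Z"
  proof (rule groupI)
    fix e assume "e \<in> carrier mu2_Z"
    then show "\<exists>e'\<in>carrier mu2_Z. e' \<otimes>\<^bsub>mu2_Z\<^esub> e = \<one>\<^bsub>mu2_Z\<^esub>"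
      by (intro bexI[of _ e]) (auto simp: mu2_Z_def power2_eq_square)
  qed (auto simp: mu2_Z_def power_mult_distrib)
  have "mu2_action f \<in> hom mu2_Z (BijGroup (H1_Oplus f))"
  proof (rule homI)
    fix e e' assume e: "e \<in> carrier mu2_Z" "e' \<in> carrier mu2_Z"
    have "mu2_action f (e * e') = compose (H1_Oplus f) (mu2_action f e) (mu2_action f e')"
      by (rule extensionalityI[of _ "H1_Oplus f"])
        (use e in \<open>auto simp: mu2_action_def[of _ "e * e'"] compose_eq simp flip: mult\<close>)
    then show "mu2_action f (e \<otimes>\<^bsub>mu2_Z\<^esub> e')
        = mu2_action f e \<otimes>\<^bsub>BijGroup (H1_Oplus f)\<^esub> mu2_action f e'"
      using bij e by (simp add: BijGroup_def mu2_Z_def)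
  qed (simp add: BijGroup_def bij)
  then show ?thesis
    using grp group_BijGroup by (simp add: group_action_def group_hom_def group_hom_axioms_def)
qed

lemma Union_proper_classes: "\<Union> (proper_class ` full_class g) = full_class g"
  unfolding proper_classes_of_full_class by (simp add: full_class_eq)

text \<open>
  The orbit of a proper class consists of the proper classes contained in the full class.
\<close>

lemma mu2_orbit_proper_class:
  assumes "proper_class g \<in> H1_Oplus f"
  shows "mu2_orbit f (proper_class g) = proper_class ` full_class g"
proof -
  have "mu2_orbit f (proper_class g)
      = {mu2_action f 1 (proper_class g), mu2_action f (- 1) (proper_class g)}"
    unfolding mu2_orbit_def orbit_def by (auto simp: carrier_mu2_Z)
  then show ?thesis
    using assms by (simp add: mu2_action_proper_class proper_classes_of_full_class)
qed

lemma Union_mu2_orbit: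
  assumes "proper_class g \<in> H1_Oplus f"
  shows "\<Union> (mu2_orbit f (proper_class g)) = full_class g"
  unfolding mu2_orbit_proper_class[OF assms] by (rule Union_proper_classes)

lemma H1_Oplus_mod_mu2_eq:
  "H1_Oplus_mod_mu2 f = {proper_class ` full_class g | g. fppf_properly_isometric f g}"
  unfolding H1_Oplus_mod_mu2_def orbits_def mu2_orbit_def[symmetric]
proof (intro equalityI subsetI; clarify)
  fix X assume "X \<in> H1_Oplus f"
  then show "\<exists>g. mu2_orbit f X = proper_class ` full_class g \<and> fppf_properly_isometric f g"
    by (elim H1_OplusE) (auto simp: mu2_orbit_proper_class proper_class_in_H1_Oplus_iff)
next
  fix g assume "fppf_properly_isometric f g"
  then have "proper_class g \<in> H1_Oplus f"
    by (simp add: proper_class_in_H1_Oplus_iff)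
  then show "\<exists>X. proper_class ` full_class g = mu2_orbit f X \<and> X \<in> H1_Oplus f"
    using mu2_orbit_proper_class by blast
qed

lemma H1_O_decomposition:
  assumes c: "c \<noteq> 0"
  shows "bij_betw (case_sum Union Union)
    (H1_Oplus_mod_mu2 (1, 0, - c) <+> H1_Oplus_mod_mu2 (1, 0, c)) (H1_O (1, 0, - c))"
proof (rule bij_betw_imageI)
  have disc: "bqf_disc \<Z> g = 4 * k" if "fppf_properly_isometric (1, 0, - k) g" for k g
    using fppf_properly_isometric_disc[OF that] by (simp add: bqf_disc_int)
  have False if "fppf_properly_isometric (1, 0, - c) g" "fppf_properly_isometric (1, 0, c) h"
    "full_class g = full_class h" for g h
  proof -
    have "bqf_disc \<Z> g = bqf_disc \<Z> h"
      using full_class_disc full_class_refl that(3) by blast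
    then show False
      using disc[OF that(1)] disc[of "- c" h] that(2) c by simp
  qed
  then show "inj_on (case_sum Union Union)
      (H1_Oplus_mod_mu2 (1, 0, - c) <+> H1_Oplus_mod_mu2 (1, 0, c))"
    unfolding H1_Oplus_mod_mu2_eq
    by (intro inj_onI) (auto simp only: Plus_def Un_iff image_iff mem_Collect_eq sum.case
        Union_proper_classes, metis+)
  have H1_O: "H1_O (1, 0, - c) = full_class ` {g. fppf_isometric (1, 0, - c) g}"
    by (simp add: H1_O_def)
  show "case_sum Union Union ` (H1_Oplus_mod_mu2 (1, 0, - c) <+> H1_Oplus_mod_mu2 (1, 0, c))
      = H1_O (1, 0, - c)"
    unfolding H1_O fppf_isometric_diagonal_iff[OF c] H1_Oplus_mod_mu2_eq Plus_def image_Un image_image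
      sum.case setcompr_eq_image Union_proper_classes Collect_disj_eq ..
qed

lemma c_dm_nonzero:
  assumes "d \<noteq> 0" "m \<ge> 1" "\<not> (d mod 4 = 1 \<and> odd m)"
  shows "c_dm d m \<noteq> 0"
proof (cases "d mod 4 = 1")
  case True
  then obtain k where k: "m = 2 * k"
    using assms(3) by auto
  then have "m\<^sup>2 * d div 4 = k\<^sup>2 * d"
    by (simp add: power_mult_distrib)
  then show ?thesis
    using True assms k by (simp add: c_dm_def)
qed (use assms in \<open>simp add: c_dm_def\<close>)

theorem lemma5p6:
  fixes d m :: int
  assumes "d \<notin> {0, 1}" and "squarefree d" and "m \<ge> 1"
    and "\<not> (d mod 4 = 1 \<and> odd m)"
  shows
    "(\<forall>f \<in> {q_dm d m, (1, 0, c_dm d m)}.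
        group_action mu2_Z (H1_Oplus f) (mu2_action f) \<and>
        (\<forall>a b c. proper_class (a, b, c) \<in> H1_Oplus f \<longrightarrow>
           mu2_action f (- 1) (proper_class (a, b, c)) = proper_class (a, - b, c))) \<and>
     (\<exists>\<Phi>. bij_betw \<Phi>
             (H1_Oplus_mod_mu2 (q_dm d m) <+> H1_Oplus_mod_mu2 (1, 0, c_dm d m))
             (H1_O (q_dm d m)) \<and>
        (\<forall>f. proper_class f \<in> H1_Oplus (q_dm d m) \<longrightarrow>
           \<Phi> (Inl (mu2_orbit (q_dm d m) (proper_class f))) = full_class f) \<and>
        (\<forall>f. proper_class f \<in> H1_Oplus (1, 0, c_dm d m) \<longrightarrow>
           \<Phi> (Inr (mu2_orbit (1, 0, c_dm d m) (proper_class f))) = full_class f))"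
proof (intro conjI ballI)
  fix f assume "f \<in> {q_dm d m, (1, 0, c_dm d m)}"
  then obtain c where f: "f = (1, 0, c)"
    by (auto simp: q_dm_def)
  show "group_action mu2_Z (H1_Oplus f) (mu2_action f)"
    unfolding f by (rule mu2_group_action)
  show "\<forall>a b c. proper_class (a, b, c) \<in> H1_Oplus f \<longrightarrow>
      mu2_action f (- 1) (proper_class (a, b, c)) = proper_class (a, - b, c)"
    by (simp add: mu2_action_proper_class bqf_flip_def)
next
  have c: "c_dm d m \<noteq> 0"
    using assms by (intro c_dm_nonzero) auto
  show "\<exists>\<Phi>. bij_betw \<Phi>
             (H1_Oplus_mod_mu2 (q_dm d m) <+> H1_Oplus_mod_mu2 (1, 0, c_dm d m))
             (H1_O (q_dm d m)) \<and>
        (\<forall>f. proper_class f \<in> H1_Oplus (q_dm d m) \<longrightarrow>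
           \<Phi> (Inl (mu2_orbit (q_dm d m) (proper_class f))) = full_class f) \<and>
        (\<forall>f. proper_class f \<in> H1_Oplus (1, 0, c_dm d m) \<longrightarrow>
           \<Phi> (Inr (mu2_orbit (1, 0, c_dm d m) (proper_class f))) = full_class f)"
    using H1_O_decomposition[OF c]
    by (intro exI[of _ "case_sum Union Union"]) (simp add: q_dm_def Union_mu2_orbit)
qed

end
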